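(* Let $p$ be a prime number, let $C$ be a positive integer, and let $\varepsilon$ and $\kappa$ be positive real numbers with $\kappa<1$. Let $\{a_n\}_{n=1}^\infty$ and $\{b_n\}_{n=1}^\infty$ be sequences of non-zero integers with $p\nmid\gcd(a_n,b_n)$ such that $\limsup_{n\to\infty}\nu_p(a_n)=\infty$ and, whenever $m\ne n$, either $\nu_p(a_m)\neq\nu_p(a_n)$ or $\nu_p(a_m)=\nu_p(a_n)\le C$. Suppose that $a_{n+1}\ge a_n\ge n^{1+\varepsilon}$ and $|b_n|\le 2^{(\log_2|a_n|)^\kappa}$ for all sufficiently large $n$. Then the sequence $\{a_n/b_n\}$ is $p$-irrational if $\limsup_{n\to\infty}|a_n|^{1/2^n}=\infty$, and it is $p$-transcendental if $\limsup_{n\to\infty}a_n^{1/A^n}=\infty$ for every positive integer $A$.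
   Context: $\nu_p$ denotes the $p$-adic valuation. For a prime $p$, a sequence $\{x_n\}_{n=1}^\infty$ of non-zero numbers is called $p$-irrational (resp. $p$-transcendental) if for every sequence $\{c_n\}_{n=1}^\infty$ of integers with $p\nmid c_n$ for all $n$, the series $\sum_{n=1}^\infty\frac{1}{x_nc_n}$ converges to an irrational (resp. transcendental) number. (Here $x_n=a_n/b_n$, so the series is $\sum_n \frac{b_n}{a_nc_n}$.) *)

theory Defs
  imports "HOL-Analysis.Analysis" "HOL-Computational_Algebra.Computational_Algebra" "HOL-Library.Liminf_Limsup"
begin

text \<open>Sequences are indexed from 1: the values at index 0 are ignored.
  A sequence x of non-zero numbers is p-irrational (resp. p-transcendental) if for every
  integer sequence c with p not dividing any c n, the series sum over n >= 1 of
  1/(x n * c n) converges to an irrational (resp. transcendental) number.\<close>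

definition p_irrational :: "nat \<Rightarrow> (nat \<Rightarrow> real) \<Rightarrow> bool" where
  "p_irrational p x \<longleftrightarrow> (\<forall>n\<ge>1. x n \<noteq> 0) \<and>
     (\<forall>c :: nat \<Rightarrow> int. (\<forall>n\<ge>1. \<not> int p dvd c n) \<longrightarrow>
        summable (\<lambda>n. 1 / (x (Suc n) * of_int (c (Suc n)))) \<and>
        (\<Sum>n. 1 / (x (Suc n) * of_int (c (Suc n)))) \<notin> \<rat>)"

definition p_transcendental :: "nat \<Rightarrow> (nat \<Rightarrow> real) \<Rightarrow> bool" where
  "p_transcendental p x \<longleftrightarrow> (\<forall>n\<ge>1. x n \<noteq> 0) \<and>
     (\<forall>c :: nat \<Rightarrow> int. (\<forall>n\<ge>1. \<not> int p dvd c n) \<longrightarrow>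
        summable (\<lambda>n. 1 / (x (Suc n) * of_int (c (Suc n)))) \<and>
        \<not> algebraic (\<Sum>n. 1 / (x (Suc n) * of_int (c (Suc n)))))"

end

theory Submission
  imports Defs "HOL-Real_Asymp.Real_Asymp"
begin

text \<open>Let \<open>x\<close> be the sum of the series and \<open>f\<close> an integer polynomial of degree \<open>D \<ge> 1\<close>. Rearrange the
  series so that the denominators \<open>\<bar>a n * c n\<bar>\<close> increase; the \<open>k\<close>-th of them still dominates \<open>a k\<close>,
  so the growth conditions survive. With \<open>A = D + 1\<close>, an argument in the style of Erdos finds
  arbitrarily late partial sums \<open>S = P / Q\<close> for which \<open>Q ^ D * \<bar>x - S\<bar>\<close> is as small as we like, and
  Liouville's argument shows that \<open>f x = 0\<close> would force \<open>f S = 0\<close>. But the largest \<open>p\<close>-adic valuation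
  among the denominators occurring in \<open>S\<close> is attained only once and is arbitrarily large, so a high
  power of \<open>p\<close> divides the reduced denominator of \<open>S\<close> and hence would divide the leading coefficient
  of \<open>f\<close>. Irrationality is the case \<open>D = 1\<close>.\<close>

section \<open>Sorting a sequence with finite sublevel sets\<close>

text \<open>Each index has only finitely many predecessors in the lexicographic order of the pairs
  \<open>(d n, n)\<close>. Counting them gives a bijection \<open>rank\<close>, whose inverse
  enumerates the indices by increasing \<open>d\<close>. The second component breaks ties, so that
  \<open>rank\<close> is injective.\<close>

lemma ex_sorting_bij:
  fixes d :: "nat \<Rightarrow> nat"
  assumes fin: "\<And>t. finite {n. d n \<le> t}"
  obtains \<sigma> :: "nat \<Rightarrow> nat" where "bij \<sigma>" "mono (\<lambda>k. d (\<sigma> k))"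
proof -
  define P where "P n = {m. d m < d n \<or> (d m = d n \<and> m < n)}" for n
  define rank where "rank n = card (P n)" for n
  have finP: "finite (P n)" for n
    by (rule finite_subset[OF _ fin[of "d n"]]) (auto simp: P_def)
  have less: "rank m < rank n" if "m \<in> P n" for m n
  proof -
    have "m \<notin> P m" by (auto simp: P_def)
    with that have "P m \<subset> P n" by (auto simp: P_def)
    thus ?thesis unfolding rank_def by (intro psubset_card_mono finP)
  qed
  have tot: "m \<in> P n \<or> n \<in> P m \<or> m = n" for m n
    by (auto simp: P_def)
  have inj: "inj rank"
    by (rule injI) (metis less less_irrefl tot)
  \<comment> \<open>The predecessors of \<open>n\<close> have distinct ranks below
    \<open>rank n\<close>, and there are exactly \<open>rank n\<close> of them, so no smaller rank
    is skipped.\<close>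
  have img: "rank ` P n = {..<rank n}" for n
  proof (rule card_subset_eq)
    show "rank ` P n \<subseteq> {..<rank n}" using less by auto
    show "card (rank ` P n) = card {..<rank n}"
      using card_image[OF inj_on_subset[OF inj subset_UNIV]] by (simp add: rank_def)
  qed auto
  have "r \<in> range rank" for r
  proof -
    have "infinite (range rank)" using inj finite_imageD by blast
    then obtain n where "r < rank n"
      by (metis (no_types, lifting) finite_nat_set_iff_bounded_le image_iff leI)
    thus ?thesis using img[of n] by blast
  qed
  hence bij: "bij rank" using inj by (auto simp: bij_def)
  show thesis
  proof (rule that)
    show "bij (inv rank)" by (rule bij_imp_bij_inv[OF bij])
    show "mono (\<lambda>k. d (inv rank k))"
    proof (rule monoI, rule ccontr)
      fix i j :: nat assume ij: "i \<le> j" and "\<not> d (inv rank i) \<le> d (inv rank j)"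
      hence "inv rank j \<in> P (inv rank i)" by (auto simp: P_def)
      from less[OF this] show False
        using ij bij by (simp add: bij_is_surj surj_f_inv_f)
    qed
  qed
qed

section \<open>Bounds for the tail of the sorted series\<close>

text \<open>From \<open>x\<close> to \<open>y\<close> the power with exponent \<kappa> grows by at
  most \<open>x powr (\<kappa> - 1) * (y - x)\<close>, because
  \<open>(y / x) powr \<kappa> \<le> y / x\<close>. The linear term wins once
  \<open>c * x powr (\<kappa> - 1) < 1\<close>.\<close>

lemma eventually_diff_powr_mono:
  fixes \<kappa> c :: real
  assumes "0 < \<kappa>" "\<kappa> < 1" "c \<ge> 0"
  shows "eventually (\<lambda>x. \<forall>y\<ge>x. x - c * x powr \<kappa> \<le> y - c * y powr \<kappa>) at_top"
proof -
  have "((\<lambda>x. c * x powr (\<kappa> - 1)) \<longlongrightarrow> 0) at_top"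
    using assms by real_asymp
  hence "eventually (\<lambda>x. c * x powr (\<kappa> - 1) < 1) at_top"
    by (rule order_tendstoD) simp
  thus ?thesis using eventually_gt_at_top[of 0]
  proof eventually_elim
    case (elim x)
    show ?case
    proof (intro allI impI)
      fix y assume y: "x \<le> y"
      have "(y / x) powr \<kappa> \<le> (y / x) powr 1"
        using y elim assms by (intro powr_mono) auto
      hence "y powr \<kappa> \<le> x powr \<kappa> * (y / x)"
        using y elim by (simp add: powr_divide field_simps)
      also have "x powr \<kappa> = x * x powr (\<kappa> - 1)"
        using elim by (simp add: powr_diff)
      finally have "y powr \<kappa> - x powr \<kappa> \<le> x powr (\<kappa> - 1) * (y - x)"
        using elim by (simp add: field_simps powr_diff)
      hence "c * (y powr \<kappa> - x powr \<kappa>) \<le> c * (x powr (\<kappa> - 1) * (y - x))"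
        using assms by (intro mult_left_mono)
      also have "\<dots> \<le> 1 * (y - x)"
        unfolding mult.assoc[symmetric] using elim y by (intro mult_right_mono) auto
      finally show "x - c * x powr \<kappa> \<le> y - c * y powr \<kappa>" by (simp add: algebra_simps)
    qed
  qed
qed

lemma summable_two_powr_minus_powr:
  fixes \<kappa> :: real
  assumes "\<kappa> > 0"
  shows "summable (\<lambda>i. 2 powr (- (real i powr \<kappa>)))"
proof (rule summable_comparison_test_ev)
  have "eventually (\<lambda>i::nat. 2 powr (- (real i powr \<kappa>)) \<le> real i powr (-2)) at_top"
    using assms by real_asymp
  thus "eventually (\<lambda>i. norm (2 powr (- (real i powr \<kappa>))) \<le> real i powr (-2)) sequentially"
    by simp
qed (simp add: summable_real_powr_iff)

text \<open>\<open>F i\<close> bounds a fraction with denominator \<open>2 powr L i\<close> and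
  numerator at most \<open>2 powr (L i powr \<kappa>)\<close>. Where \<open>i \<le> L i\<close>, it
  is at most a quantity depending on \<open>L m\<close> times the summable
  \<open>2 powr (- (i powr \<kappa>))\<close>. The other indices lie beyond \<open>n\<close>, where
  a summable power of \<open>i\<close> times \<open>2 powr (- \<gamma> * L n)\<close>
  suffices.\<close>

lemma tail_bound:
  fixes L :: "nat \<Rightarrow> real" and \<kappa> \<epsilon> :: real
  assumes \<kappa>: "0 < \<kappa>" "\<kappa> < 1" and \<epsilon>: "\<epsilon> > 0"
    and mono: "mono L" and lower: "eventually (\<lambda>i. L i \<ge> (1 + \<epsilon>) * log 2 (real i)) sequentially"
  defines "F \<equiv> \<lambda>i. 2 powr (L i powr \<kappa> - L i)"
  shows "summable F"
    and "\<exists>\<gamma> K. 0 < \<gamma> \<and> 0 < K \<and> eventually (\<lambda>m. \<forall>n\<ge>m. (\<forall>i\<in>{m..n}. real i \<le> L i) \<longrightarrow>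
           (\<Sum>i. F (i + m)) \<le> K * (2 powr (2 * L m powr \<kappa> - L m) + 2 powr (- \<gamma> * L n))) sequentially"
proof -
  \<comment> \<open>With this value
    \<open>(1 - 2 * \<gamma>) * (1 + \<epsilon>) = 1 + \<epsilon> / 2\<close>: one
    \<open>\<gamma> * L i\<close> absorbs \<open>L i powr \<kappa>\<close>, a second one becomes the
    decay factor, and the rest of \<open>L i\<close> still yields a summable power of
    \<open>i\<close>.\<close>
  define \<gamma> where "\<gamma> = \<epsilon> / (4 * (1 + \<epsilon>))"
  have \<gamma>: "\<gamma> > 0" using \<epsilon> by (simp add: \<gamma>_def)
  have \<gamma>': "(1 - 2 * \<gamma>) * (1 + \<epsilon>) = 1 + \<epsilon> / 2" "1 - 2 * \<gamma> > 0"
    using \<epsilon> by (auto simp: \<gamma>_def field_simps)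
  have top: "filterlim L at_top sequentially"
    by (rule filterlim_at_top_mono[OF _ lower]) (use \<epsilon> in real_asymp)
  have "eventually (\<lambda>x. x powr \<kappa> \<le> \<gamma> * x) at_top"
    using \<kappa> \<gamma> by real_asymp
  from eventually_compose_filterlim[OF this top]
  have ev1: "eventually (\<lambda>i. L i powr \<kappa> \<le> \<gamma> * L i) sequentially" .
  have split: "eventually (\<lambda>i. F i \<le> 2 powr (- \<gamma> * L i) * real i powr (- (1 + \<epsilon> / 2))) sequentially"
    using ev1 lower eventually_gt_at_top[of 0]
  proof eventually_elim
    case (elim i)
    have "(1 - 2 * \<gamma>) * ((1 + \<epsilon>) * log 2 (real i)) \<le> (1 - 2 * \<gamma>) * L i"
      using elim \<gamma>' by (intro mult_left_mono) auto
    hence "(1 + \<epsilon> / 2) * log 2 (real i) \<le> (1 - 2 * \<gamma>) * L i"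
      unfolding mult.assoc[symmetric] \<gamma>' .
    hence "L i powr \<kappa> - L i \<le> - \<gamma> * L i + log 2 (real i) * (- (1 + \<epsilon> / 2))"
      using elim(1) by (simp add: algebra_simps)
    hence "F i \<le> 2 powr (- \<gamma> * L i + log 2 (real i) * (- (1 + \<epsilon> / 2)))"
      unfolding F_def by (intro powr_mono) auto
    also have "\<dots> = 2 powr (- \<gamma> * L i) * (2 powr log 2 (real i)) powr (- (1 + \<epsilon> / 2))"
      by (simp only: powr_add powr_powr)
    finally show ?case using elim by simp
  qed
  have sum_pow: "summable (\<lambda>i. real i powr (- (1 + \<epsilon> / 2)))"
    using \<epsilon> by (simp add: summable_real_powr_iff)
  have Lpos: "eventually (\<lambda>i. L i > 0) sequentially"
    using top by (simp add: filterlim_at_top_dense)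
  show summ: "summable F"
  proof (rule summable_comparison_test_ev[OF _ sum_pow])
    show "eventually (\<lambda>i. norm (F i) \<le> real i powr (- (1 + \<epsilon> / 2))) sequentially"
      using split Lpos
    proof eventually_elim
      case (elim i)
      have "2 powr (- \<gamma> * L i) \<le> 2 powr 0" using elim \<gamma> by (intro powr_mono) auto
      hence "2 powr (- \<gamma> * L i) * real i powr (- (1 + \<epsilon> / 2)) \<le> 1 * real i powr (- (1 + \<epsilon> / 2))"
        by (intro mult_right_mono) auto
      with elim show ?case by (simp add: F_def)
    qed
  qed
  define K1 where "K1 = (\<Sum>i. 2 powr (- (real i powr \<kappa>)))"
  define K2 where "K2 = (\<Sum>i. real i powr (- (1 + \<epsilon> / 2)))"
  define K where "K = max 1 (max K1 K2)"
  \<comment> \<open>The coefficient 2 provides two copies of \<open>L i powr \<kappa>\<close>: one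
    cancels the copy in \<open>F i\<close>, the other is at least \<open>i powr \<kappa>\<close>
    when \<open>i \<le> L i\<close> and makes the bound summable.\<close>
  have "eventually (\<lambda>i. \<forall>y\<ge>L i. L i - 2 * L i powr \<kappa> \<le> y - 2 * y powr \<kappa>) sequentially"
    using eventually_compose_filterlim[OF eventually_diff_powr_mono[of \<kappa> 2] top] \<kappa> by simp
  moreover have "eventually (\<lambda>m. \<forall>i\<ge>m. F i \<le> 2 powr (- \<gamma> * L i) * real i powr (- (1 + \<epsilon> / 2))) sequentially"
    using split by (simp add: eventually_all_ge_at_top)
  ultimately have "eventually (\<lambda>m. \<forall>n\<ge>m. (\<forall>i\<in>{m..n}. real i \<le> L i) \<longrightarrow>
      (\<Sum>i. F (i + m)) \<le> K * (2 powr (2 * L m powr \<kappa> - L m) + 2 powr (- \<gamma> * L n))) sequentially"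
  proof eventually_elim
    case (elim m)
    show ?case
    proof (intro allI impI)
      fix n assume n: "m \<le> n" and big: "\<forall>i\<in>{m..n}. real i \<le> L i"
      define u where "u = 2 powr (2 * L m powr \<kappa> - L m)"
      define v where "v = 2 powr (- \<gamma> * L n)"
      let ?G = "\<lambda>i. u * 2 powr (- (real i powr \<kappa>)) + v * real i powr (- (1 + \<epsilon> / 2))"
      have le: "F i \<le> ?G i" if i: "i \<ge> m" for i
      proof (cases "real i \<le> L i")
        case True
        have "L m \<le> L i" using mono i by (simp add: monoD)
        hence "L m - 2 * L m powr \<kappa> \<le> L i - 2 * L i powr \<kappa>" using elim by simp
        moreover have "real i powr \<kappa> \<le> L i powr \<kappa>"
          using True \<kappa> by (intro powr_mono2) auto
        ultimately have "L i powr \<kappa> - L i \<le> (2 * L m powr \<kappa> - L m) + (- (real i powr \<kappa>))"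
          by simp
        hence "F i \<le> 2 powr ((2 * L m powr \<kappa> - L m) + (- (real i powr \<kappa>)))"
          unfolding F_def by (intro powr_mono) auto
        also have "\<dots> = u * 2 powr (- (real i powr \<kappa>))"
          by (simp add: u_def powr_add[symmetric])
        also have "\<dots> \<le> ?G i" by (simp add: v_def)
        finally show ?thesis .
      next
        case False
        hence "n \<le> i" using big i by force
        hence "L n \<le> L i" using mono by (simp add: monoD)
        hence "2 powr (- \<gamma> * L i) \<le> v"
          unfolding v_def using \<gamma> by (intro powr_mono) auto
        hence "2 powr (- \<gamma> * L i) * real i powr (- (1 + \<epsilon> / 2)) \<le> v * real i powr (- (1 + \<epsilon> / 2))"
          by (intro mult_right_mono) auto
        moreover have "F i \<le> 2 powr (- \<gamma> * L i) * real i powr (- (1 + \<epsilon> / 2))"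
          using elim i by blast
        ultimately show ?thesis by (simp add: u_def add_increasing)
      qed
      have s1: "summable (\<lambda>i. u * 2 powr (- (real i powr \<kappa>)))"
        using summable_two_powr_minus_powr[OF \<kappa>(1)] by (rule summable_mult)
      have s2: "summable (\<lambda>i. v * real i powr (- (1 + \<epsilon> / 2)))"
        using sum_pow by (rule summable_mult)
      have sG: "summable ?G" by (rule summable_add[OF s1 s2])
      have "(\<Sum>i. F (i + m)) \<le> (\<Sum>i. ?G (i + m))"
      proof (rule suminf_le)
        show "summable (\<lambda>i. F (i + m))" using summ by (rule summable_ignore_initial_segment)
        show "summable (\<lambda>i. ?G (i + m))" using sG by (rule summable_ignore_initial_segment)
      qed (rule le, simp)
      also have "\<dots> = (\<Sum>i. ?G i) - (\<Sum>i<m. ?G i)"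
        by (rule suminf_minus_initial_segment[OF sG])
      also have "\<dots> \<le> (\<Sum>i. ?G i)"
        by (simp add: u_def v_def sum_nonneg)
      also have "\<dots> = u * K1 + v * K2"
        unfolding K1_def K2_def
        by (subst suminf_add[OF s1 s2, symmetric])
           (simp only: suminf_mult[OF sum_pow] suminf_mult[OF summable_two_powr_minus_powr[OF \<kappa>(1)]])
      also have "\<dots> \<le> u * K + v * K"
        unfolding K_def u_def v_def by (intro add_mono mult_left_mono) auto
      finally show "(\<Sum>i. F (i + m)) \<le> K * (2 powr (2 * L m powr \<kappa> - L m) + 2 powr (- \<gamma> * L n))"
        by (simp add: u_def v_def algebra_simps)
    qed
  qed
  moreover have "K > 0" by (simp add: K_def)
  ultimately show "\<exists>\<gamma> K. 0 < \<gamma> \<and> 0 < K \<and> eventually (\<lambda>m. \<forall>n\<ge>m. (\<forall>i\<in>{m..n}. real i \<le> L i) \<longrightarrow>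
           (\<Sum>i. F (i + m)) \<le> K * (2 powr (2 * L m powr \<kappa> - L m) + 2 powr (- \<gamma> * L n))) sequentially"
    using \<gamma> by blast
qed

section \<open>Choosing where to cut the series\<close>

text \<open>If \<open>m\<close> is the first index at which \<open>L m\<close> exceeds \<open>\<rho> * (2 - 1 / (m + 1)) * A ^ m\<close>, then, since
  \<open>A - 1\<close> times the sum of \<open>A ^ j\<close> over \<open>j < m\<close> is below \<open>A ^ m\<close>, the slow increase of the factor
  \<open>2 - 1 / (m + 1)\<close> leaves a gain of order \<open>L m / m\<^sup>2\<close>. This beats \<open>L m powr \<kappa>\<close> because \<open>L m\<close> is at
  least exponential in \<open>m\<close>.\<close>
lemma eventually_gain:
  fixes \<kappa> A W :: real
  assumes \<kappa>: "0 < \<kappa>" "\<kappa> < 1" and A: "A > 1"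
  shows "eventually (\<lambda>m. \<forall>(L :: nat \<Rightarrow> real) \<rho> k. 0 < \<rho> \<and> k \<le> m \<and> sqrt A ^ m \<le> \<rho> * A ^ m \<and>
           (\<Sum>j<k. L j) \<le> (real m)\<^sup>2 \<and> (\<forall>j\<in>{k..<m}. L j \<le> \<rho> * (2 - 1 / (real j + 1)) * A ^ j) \<and>
           L m > \<rho> * (2 - 1 / (real m + 1)) * A ^ m \<longrightarrow>
           (A - 1) * (\<Sum>j<m. L j) + 2 * L m powr \<kappa> + W \<le> L m) sequentially"
proof -
  define s where "s = sqrt A"
  have s: "s > 1" using A by (simp add: s_def)
  \<comment> \<open>The gain will be \<open>L m / (2 * (real m + 1)\<^sup>2)\<close>. By this bound
    one half of it pays for \<open>2 * L m powr \<kappa>\<close>; by the next bound the other half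
    pays for the first \<open>k\<close> summands and \<open>W\<close>.\<close>
  have "eventually (\<lambda>m::nat. (s ^ m) powr (1 - \<kappa>) \<ge> 8 * (real m + 1)\<^sup>2) sequentially"
    using s \<kappa> by real_asymp
  moreover have "eventually (\<lambda>m::nat. s ^ m / (4 * (real m + 1)\<^sup>2) \<ge> (A - 1) * (real m)\<^sup>2 + W) sequentially"
    using s by real_asymp
  ultimately show ?thesis using eventually_gt_at_top[of 0]
  proof eventually_elim
    case (elim m)
    show ?case
    proof (intro allI impI, elim conjE)
      fix L :: "nat \<Rightarrow> real" and \<rho> :: real and k :: nat
      assume \<rho>: "0 < \<rho>" and km: "k \<le> m" and low: "sqrt A ^ m \<le> \<rho> * A ^ m"
        and init: "(\<Sum>j<k. L j) \<le> (real m)\<^sup>2"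
        and below: "\<forall>j\<in>{k..<m}. L j \<le> \<rho> * (2 - 1 / (real j + 1)) * A ^ j"
        and above: "L m > \<rho> * (2 - 1 / (real m + 1)) * A ^ m"
      have m: "real m > 0" using elim by simp
      define X where "X = \<rho> * A ^ m"
      have X: "X > 0" using \<rho> A by (simp add: X_def)
      have above': "L m > (2 - 1 / (real m + 1)) * X"
        using above by (simp add: X_def mult_ac)
      have "1 * X \<le> (2 - 1 / (real m + 1)) * X"
        using X by (intro mult_right_mono) (auto simp: field_simps)
      with above' have XL: "X \<le> L m" by simp
      hence sL: "s ^ m \<le> L m" using low by (simp add: X_def s_def)
      have sm: "s ^ m > 0" using s by simp
      have Lpos: "L m > 0" using sL sm by linarith
      have "(\<Sum>j=k..<m. L j) \<le> (\<Sum>j=k..<m. \<rho> * (2 - 1 / real m) * A ^ j)"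
      proof (rule sum_mono)
        fix j assume j: "j \<in> {k..<m}"
        have "1 / real m \<le> 1 / (real j + 1)" using j by (intro divide_left_mono) auto
        hence "\<rho> * (2 - 1 / (real j + 1)) * A ^ j \<le> \<rho> * (2 - 1 / real m) * A ^ j"
          using \<rho> A by (intro mult_right_mono mult_left_mono) auto
        thus "L j \<le> \<rho> * (2 - 1 / real m) * A ^ j" using below j by force
      qed
      also have "\<dots> \<le> (\<Sum>j<m. \<rho> * (2 - 1 / real m) * A ^ j)"
        using \<rho> A elim(3) by (intro sum_mono2) (auto simp: field_simps)
      also have "\<dots> = \<rho> * (2 - 1 / real m) * ((A ^ m - 1) / (A - 1))"
        using A by (simp add: sum_distrib_left[symmetric] geometric_sum)
      finally have "(A - 1) * (\<Sum>j=k..<m. L j) \<le> \<rho> * (2 - 1 / real m) * (A ^ m - 1)"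
        using A by (simp add: field_simps)
      also have "\<dots> \<le> \<rho> * (2 - 1 / real m) * A ^ m"
        using \<rho> elim(3) by (intro mult_left_mono) (auto simp: field_simps)
      finally have win: "(A - 1) * (\<Sum>j=k..<m. L j) \<le> (2 - 1 / real m) * X"
        by (simp add: X_def mult_ac)
      have "(2 - 1 / real m) * X \<le> L m - L m / (2 * (real m + 1)\<^sup>2)"
      proof -
        \<comment> \<open>The quotient of \<open>2 - 1 / m\<close> by \<open>2 - 1 / (m + 1)\<close>
          is exactly \<open>1 - 1 / (m * (2 * m + 1))\<close>, and
          \<open>m * (2 * m + 1) \<le> 2 * (m + 1)\<^sup>2\<close>.\<close>
        have "2 - 1 / real m \<le> (2 - 1 / (real m + 1)) * (1 - 1 / (2 * (real m + 1)\<^sup>2))"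
          using m by (simp add: divide_simps power2_eq_square) (simp add: algebra_simps)
        hence "(2 - 1 / real m) * X \<le> (2 - 1 / (real m + 1)) * (1 - 1 / (2 * (real m + 1)\<^sup>2)) * X"
          using X by (intro mult_right_mono) auto
        also have "\<dots> = ((2 - 1 / (real m + 1)) * X) * (1 - 1 / (2 * (real m + 1)\<^sup>2))"
          by simp
        also have "\<dots> \<le> L m * (1 - 1 / (2 * (real m + 1)\<^sup>2))"
        proof (intro mult_right_mono)
          have "1 \<le> (real m + 1)\<^sup>2" using m by (simp add: power2_eq_square algebra_simps)
          hence "1 \<le> 2 * (real m + 1)\<^sup>2" by linarith
          thus "0 \<le> 1 - 1 / (2 * (real m + 1)\<^sup>2)" by simp
        qed (use above' in auto)
        finally show ?thesis by (simp add: algebra_simps)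
      qed
      moreover have "(A - 1) * (\<Sum>j<m. L j) = (A - 1) * (\<Sum>j<k. L j) + (A - 1) * (\<Sum>j=k..<m. L j)"
        using sum.atLeastLessThan_concat[of 0 k m L] km
        by (simp add: lessThan_atLeast0 distrib_left[symmetric])
      moreover have "(A - 1) * (\<Sum>j<k. L j) \<le> (A - 1) * (real m)\<^sup>2"
        using init A by (intro mult_left_mono) auto
      moreover have "2 * L m powr \<kappa> \<le> L m / (4 * (real m + 1)\<^sup>2)"
      proof -
        have "8 * (real m + 1)\<^sup>2 \<le> (s ^ m) powr (1 - \<kappa>)" using elim by simp
        also have "\<dots> \<le> L m powr (1 - \<kappa>)" using sL sm \<kappa> by (intro powr_mono2) auto
        finally have "8 * (real m + 1)\<^sup>2 * L m powr \<kappa> \<le> L m powr (1 - \<kappa>) * L m powr \<kappa>"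
          by (intro mult_right_mono) auto
        also have "\<dots> = L m" using Lpos by (simp add: powr_add[symmetric])
        finally show ?thesis using m by (simp add: field_simps)
      qed
      moreover have "(A - 1) * (real m)\<^sup>2 + W \<le> L m / (4 * (real m + 1)\<^sup>2)"
      proof -
        have "s ^ m / (4 * (real m + 1)\<^sup>2) \<le> L m / (4 * (real m + 1)\<^sup>2)"
          using sL by (intro divide_right_mono) auto
        with elim show ?thesis by linarith
      qed
      moreover have "L m / (2 * (real m + 1)\<^sup>2) = L m / (4 * (real m + 1)\<^sup>2) + L m / (4 * (real m + 1)\<^sup>2)"
        by (simp add: field_simps)
      ultimately show "(A - 1) * (\<Sum>j<m. L j) + 2 * L m powr \<kappa> + W \<le> L m"
        using win by linarith
    qed
  qed
qed

text \<open>The sequence \<open>L\<close> may stagnate for a very long time. If \<open>L i < i\<close> infinitely often, the search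
  for \<open>m\<close> therefore starts at the last such index \<open>k\<close> before some \<open>n\<close> with \<open>A ^ n \<le> L n\<close>, with the
  tiny \<open>\<rho> = sqrt A powr (- k)\<close>: any stagnation after \<open>m\<close> then takes place beyond \<open>n\<close>, at a height
  where the crude tail bound \<open>2 powr (- \<gamma> * L n)\<close> is good enough.\<close>
lemma ex_good_window:
  fixes L :: "nat \<Rightarrow> real" and \<kappa> \<gamma> A W :: real
  assumes \<kappa>: "0 < \<kappa>" "\<kappa> < 1" and A: "A \<ge> 2" and \<gamma>: "\<gamma> > 0"
    and mono: "mono L" and nonneg: "\<And>i. L i \<ge> 0"
    and growth: "\<And>K. frequently (\<lambda>n. L n \<ge> K * A ^ n) sequentially"
  obtains m n where "m \<ge> M" "n \<ge> m" "\<forall>i\<in>{m..n}. real i \<le> L i"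
    "(A - 1) * (\<Sum>j<m. L j) + 2 * L m powr \<kappa> + W \<le> L m"
    "(A - 1) * (\<Sum>j<m. L j) + W \<le> \<gamma> * L n"
proof -
  have A1: "A > 1" using A by simp
  \<comment> \<open>The threshold \<open>M0\<close> is uniform in \<rho> and \<open>k\<close>, which
    matters because \<rho> is fixed only after \<open>M0\<close>, in the second case through an
    index \<open>k \<ge> M0\<close>.\<close>
  obtain M0 where gain: "\<And>m L \<rho> k. m \<ge> M0 \<Longrightarrow> 0 < \<rho> \<Longrightarrow> k \<le> m \<Longrightarrow> sqrt A ^ m \<le> \<rho> * A ^ m \<Longrightarrow>
           (\<Sum>j<k. L j) \<le> (real m)\<^sup>2 \<Longrightarrow> (\<forall>j\<in>{k..<m}. L j \<le> \<rho> * (2 - 1 / (real j + 1)) * A ^ j) \<Longrightarrow>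
           L m > \<rho> * (2 - 1 / (real m + 1)) * A ^ m \<Longrightarrow>
           (A - 1) * (\<Sum>j<m. L j) + 2 * L m powr \<kappa> + W \<le> L m"
    using eventually_gain[OF \<kappa> A1, of W] unfolding eventually_sequentially by blast
  have growth': "\<exists>n\<ge>N. L n \<ge> K * A ^ n" for N K
    using growth[of K] by (auto simp: frequently_sequentially)
  have frac: "1 / (real j + 1) \<le> 1" "1 / (real j + 1) > 0" for j by auto
  have pow_ge: "real n \<le> A ^ n" for n
  proof -
    have "real n \<le> 2 ^ n" using of_nat_less_two_power[of n, where 'a=real] by simp
    also have "\<dots> \<le> A ^ n" using A by (intro power_mono) auto
    finally show ?thesis .
  qed
  show thesis
  proof (cases "eventually (\<lambda>i. real i \<le> L i) sequentially")
    \<comment> \<open>Here the condition \<open>i \<le> L i\<close> holds from \<open>N0\<close> on,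
      so \<open>n\<close> may be taken as far out as the last inequality requires, and the search
      needs no initial block (\<open>k = 0\<close>).\<close>
    case True
    then obtain N0 where N0: "\<And>i. i \<ge> N0 \<Longrightarrow> real i \<le> L i"
      by (auto simp: eventually_sequentially)
    define M' where "M' = max M (max M0 N0)"
    \<comment> \<open>Being at least \<open>L M'\<close>, this \<rho> keeps all
      \<open>j \<le> M'\<close> below the barrier, so the first crossing \<open>m\<close> comes
      after \<open>M'\<close>. A crossing exists because the barrier stays below
      \<open>2 * \<rho> * A ^ n\<close>.\<close>
    define \<rho> where "\<rho> = max 1 (L M')"
    have \<rho>: "\<rho> \<ge> 1" by (simp add: \<rho>_def)
    define P where "P m \<longleftrightarrow> L m > \<rho> * (2 - 1 / (real m + 1)) * A ^ m" for m
    obtain n0 where n0: "L n0 \<ge> 2 * \<rho> * A ^ n0" using growth'[of 0 "2 * \<rho>"] by blast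
    have "\<rho> * (2 - 1 / (real n0 + 1)) * A ^ n0 < 2 * \<rho> * A ^ n0"
      using \<rho> A by (simp add: field_simps)
    hence "P n0" using n0 by (simp add: P_def)
    define m where "m = (LEAST m. P m)"
    have Pm: "P m" unfolding m_def by (rule LeastI[of P, OF \<open>P n0\<close>])
    have notP: "\<not> P j" if "j < m" for j using that not_less_Least unfolding m_def by blast
    have "\<not> P j" if "j \<le> M'" for j
    proof -
      have "L j \<le> L M'" using mono that by (simp add: monoD)
      also have "\<dots> \<le> \<rho> * 1 * 1" by (simp add: \<rho>_def)
      also have "\<dots> \<le> \<rho> * (2 - 1 / (real j + 1)) * A ^ j"
        using \<rho> A frac(1)[of j] by (intro mult_mono) (auto intro!: mult_nonneg_nonneg simp: field_simps)
      finally show ?thesis by (simp add: P_def)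
    qed
    with Pm have mM': "m > M'" by (meson not_le)
    obtain n where n: "n \<ge> m" "L n \<ge> (((A - 1) * (\<Sum>j<m. L j) + W) / \<gamma>)"
    proof -
      define Z where "Z = ((A - 1) * (\<Sum>j<m. L j) + W) / \<gamma>"
      obtain n where "n \<ge> m" "L n \<ge> max 0 Z * A ^ n" using growth' by blast
      moreover have "max 0 Z * 1 \<le> max 0 Z * A ^ n" using A by (intro mult_left_mono) auto
      ultimately show thesis using that[of n] by (simp add: Z_def)
    qed
    show thesis
    proof (rule that[of m n])
      show "(A - 1) * (\<Sum>j<m. L j) + 2 * L m powr \<kappa> + W \<le> L m"
      proof (rule gain[of m \<rho> 0])
        have "sqrt A ^ m \<le> A ^ m" using A by (intro power_mono) (auto intro!: real_le_lsqrt simp: power2_eq_square)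
        also have "\<dots> \<le> \<rho> * A ^ m" using \<rho> A by simp
        finally show "sqrt A ^ m \<le> \<rho> * A ^ m" .
        show "\<forall>j\<in>{0..<m}. L j \<le> \<rho> * (2 - 1 / (real j + 1)) * A ^ j"
          using notP by (auto simp: P_def not_less)
        show "\<rho> * (2 - 1 / (real m + 1)) * A ^ m < L m" using Pm by (simp add: P_def)
      qed (use mM' \<rho> in \<open>auto simp: M'_def\<close>)
      show "(A - 1) * (\<Sum>j<m. L j) + W \<le> \<gamma> * L n"
        using n(2) \<gamma> by (simp add: field_simps)
    qed (use mM' n N0 in \<open>auto simp: M'_def\<close>)
  next
    case False
    define s where "s = sqrt A"
    have s: "s > 1" "s * s = A" using A1 by (auto simp: s_def)
    \<comment> \<open>With \<open>\<rho> = 1 / s ^ k\<close>, the four bounds give in turn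
      \<open>2 * \<rho> \<le> \<gamma> / 2\<close>, control of the first \<open>k\<close> summands
      and \<open>W\<close>, \<open>2 * \<rho> \<le> 1\<close> (so that \<open>n\<close> lies above
      the barrier), and \<open>L k < k \<le> s ^ k\<close> (so that \<open>k\<close> lies below
      it).\<close>
    have "eventually (\<lambda>k::nat. 2 / s ^ k \<le> \<gamma> / 2) sequentially"
      using s \<gamma> by real_asymp
    moreover have "eventually (\<lambda>k::nat. (A - 1) * (real k)\<^sup>2 + W \<le> \<gamma> / 2 * A ^ k) sequentially"
      using A1 \<gamma> by real_asymp
    moreover have "eventually (\<lambda>k::nat. 2 \<le> s ^ k) sequentially"
      using s by real_asymp
    moreover have "eventually (\<lambda>k::nat. real k \<le> s ^ k) sequentially"
      using s by real_asymp
    ultimately have "eventually (\<lambda>k::nat. 2 / s ^ k \<le> \<gamma> / 2 \<and> (A - 1) * (real k)\<^sup>2 + W \<le> \<gamma> / 2 * A ^ k \<and> 2 \<le> s ^ k \<and> real k \<le> s ^ k) sequentially"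
      by eventually_elim auto
    then obtain M1 where M1: "\<And>k. k \<ge> M1 \<Longrightarrow> 2 / s ^ k \<le> \<gamma> / 2"
      "\<And>k. k \<ge> M1 \<Longrightarrow> (A - 1) * (real k)\<^sup>2 + W \<le> \<gamma> / 2 * A ^ k" "\<And>k. k \<ge> M1 \<Longrightarrow> 2 \<le> s ^ k"
      "\<And>k. k \<ge> M1 \<Longrightarrow> real k \<le> s ^ k"
      unfolding eventually_sequentially by blast
    define M' where "M' = max M (max M0 M1)"
    obtain k0 where k0: "k0 \<ge> M'" "L k0 < real k0"
      using False unfolding eventually_sequentially by (meson not_le)
    obtain n where n: "n > k0" "L n \<ge> 1 * A ^ n" using growth'[of "Suc k0" 1] by (auto simp: Suc_le_eq)
    define k where "k = Max {i. i < n \<and> L i < real i}"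
    have fin: "finite {i. i < n \<and> L i < real i}" by simp
    have "k \<in> {i. i < n \<and> L i < real i}" unfolding k_def
      by (rule Max_in[OF fin]) (use k0 n in auto)
    hence k: "k < n" "L k < real k" by auto
    have "k0 \<le> k" unfolding k_def by (rule Max_ge[OF fin]) (use k0 n in auto)
    hence kM: "k \<ge> M" "k \<ge> M0" "k \<ge> M1" using k0 by (auto simp: M'_def)
    have big: "real i \<le> L i" if "k < i" "i \<le> n" for i
    proof (cases "i = n")
      case True thus ?thesis using n pow_ge[of n] by simp
    next
      case False
      show ?thesis
      proof (rule ccontr)
        assume "\<not> real i \<le> L i"
        hence "i \<le> k" unfolding k_def using False that by (intro Max_ge[OF fin]) auto
        thus False using that by simp
      qed
    qed
    define \<rho> where "\<rho> = 1 / s ^ k"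
    have \<rho>: "\<rho> > 0" using s by (simp add: \<rho>_def)
    have \<rho>2: "2 * \<rho> \<le> 1" "2 * \<rho> \<le> \<gamma> / 2" using M1[of k] kM s by (auto simp: \<rho>_def field_simps)
    \<comment> \<open>Since \<open>A = s * s\<close>, the left side equals
      \<open>s ^ (2 * m - k)\<close>.\<close>
    have \<rho>s: "\<rho> * A ^ m \<ge> s ^ m" if "m \<ge> k" for m
    proof -
      have "s ^ m * s ^ k \<le> s ^ m * s ^ m" using s that by (intro mult_left_mono power_increasing) auto
      also have "\<dots> = A ^ m" using s by (simp add: power_mult_distrib[symmetric])
      finally show ?thesis using s by (simp add: \<rho>_def field_simps)
    qed
    define P where "P m \<longleftrightarrow> k < m \<and> L m > \<rho> * (2 - 1 / (real m + 1)) * A ^ m" for m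
    have "P n"
    proof -
      have "\<rho> * (2 - 1 / (real n + 1)) * A ^ n < 2 * \<rho> * A ^ n"
        using \<rho> A by (simp add: field_simps)
      also have "\<dots> \<le> 1 * A ^ n" using \<rho>2 A by (intro mult_right_mono) auto
      finally show ?thesis using n k by (simp add: P_def)
    qed
    define m where "m = (LEAST m. P m)"
    have Pm: "P m" unfolding m_def by (rule LeastI[of P, OF \<open>P n\<close>])
    have notP: "\<not> P j" if "j < m" for j using that not_less_Least unfolding m_def by blast
    have mn: "m \<le> n" unfolding m_def by (rule Least_le[of P, OF \<open>P n\<close>])
    have km: "k < m" using Pm by (simp add: P_def)
    \<comment> \<open>Minimality of \<open>m\<close> gives no information at \<open>k\<close>,
      because \<open>P\<close> only speaks of indices above \<open>k\<close>.\<close>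
    have Lk: "L k \<le> \<rho> * (2 - 1 / (real k + 1)) * A ^ k"
    proof -
      have "L k \<le> s ^ k" using k M1(4)[OF kM(3)] by simp
      also have "\<dots> \<le> (\<rho> * A ^ k) * 1" using \<rho>s[of k] by simp
      also have "\<dots> \<le> (\<rho> * A ^ k) * (2 - 1 / (real k + 1))"
        using \<rho> A frac[of k] by (intro mult_left_mono) auto
      finally show ?thesis by (simp add: mult_ac)
    qed
    have below: "\<forall>j\<in>{k..<m}. L j \<le> \<rho> * (2 - 1 / (real j + 1)) * A ^ j"
    proof
      fix j assume "j \<in> {k..<m}"
      thus "L j \<le> \<rho> * (2 - 1 / (real j + 1)) * A ^ j"
        using Lk notP[of j] by (cases "j = k") (auto simp: P_def not_less)
    qed
    have "(\<Sum>j<k. L j) \<le> (\<Sum>j<k. real k)"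
    proof (rule sum_mono)
      fix j assume "j \<in> {..<k}"
      hence "L j \<le> L k" using mono by (simp add: monoD)
      thus "L j \<le> real k" using k by simp
    qed
    hence init: "(\<Sum>j<k. L j) \<le> (real k)\<^sup>2" by (simp add: power2_eq_square)
    have "(real k)\<^sup>2 \<le> (real m)\<^sup>2" using km by (intro power_mono) auto
    show thesis
    proof (rule that[of m n])
      show "(A - 1) * (\<Sum>j<m. L j) + 2 * L m powr \<kappa> + W \<le> L m"
      proof (rule gain[of m \<rho> k])
        show "sqrt A ^ m \<le> \<rho> * A ^ m" using \<rho>s[of m] km by (simp add: s_def)
        show "\<rho> * (2 - 1 / (real m + 1)) * A ^ m < L m" using Pm by (simp add: P_def)
        show "(\<Sum>j<k. L j) \<le> (real m)\<^sup>2" using init \<open>(real k)\<^sup>2 \<le> (real m)\<^sup>2\<close> by linarith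
      qed (use below km kM \<rho> in auto)
      show "(A - 1) * (\<Sum>j<m. L j) + W \<le> \<gamma> * L n"
      proof -
        \<comment> \<open>Both halves of \<gamma> are used, together with \<open>m \<le> n\<close>
          and \<open>A ^ n \<le> L n\<close>: since \<open>2 * \<rho> \<le> \<gamma> / 2\<close>,
          one half pays for the summands from \<open>k\<close> to \<open>m\<close>; the other pays
          for the first \<open>k\<close> summands and \<open>W\<close>.\<close>
        have "(\<Sum>j=k..<m. L j) \<le> (\<Sum>j=k..<m. 2 * \<rho> * A ^ j)"
        proof (rule sum_mono)
          fix j assume "j \<in> {k..<m}"
          hence "L j \<le> \<rho> * (2 - 1 / (real j + 1)) * A ^ j" using below by blast
          also have "\<dots> \<le> 2 * \<rho> * A ^ j"
            using \<rho> A by (simp add: field_simps)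
          finally show "L j \<le> 2 * \<rho> * A ^ j" .
        qed
        also have "\<dots> \<le> (\<Sum>j<m. 2 * \<rho> * A ^ j)"
          using \<rho> A by (intro sum_mono2) auto
        also have "\<dots> = 2 * \<rho> * ((A ^ m - 1) / (A - 1))"
          using A by (simp add: sum_distrib_left[symmetric] geometric_sum)
        finally have "(A - 1) * (\<Sum>j=k..<m. L j) \<le> 2 * \<rho> * (A ^ m - 1)"
          using A by (simp add: field_simps)
        also have "\<dots> \<le> 2 * \<rho> * A ^ m" using \<rho> by simp
        also have "\<dots> \<le> \<gamma> / 2 * A ^ n"
          using \<rho>2 \<gamma> A mn by (intro mult_mono power_increasing) auto
        finally have "(A - 1) * (\<Sum>j=k..<m. L j) \<le> \<gamma> / 2 * A ^ n" .
        moreover have "(A - 1) * (\<Sum>j<m. L j) = (A - 1) * (\<Sum>j<k. L j) + (A - 1) * (\<Sum>j=k..<m. L j)"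
          using sum.atLeastLessThan_concat[of 0 k m L] km
          by (simp add: lessThan_atLeast0 distrib_left[symmetric])
        moreover have "(A - 1) * (\<Sum>j<k. L j) \<le> (A - 1) * (real k)\<^sup>2"
          using init A by (intro mult_left_mono) auto
        moreover have "(A - 1) * (real k)\<^sup>2 + W \<le> \<gamma> / 2 * A ^ k" using M1 kM by blast
        moreover have "\<gamma> / 2 * A ^ k \<le> \<gamma> / 2 * A ^ n"
          using \<gamma> A k by (intro mult_left_mono power_increasing) auto
        moreover have "\<gamma> * A ^ n \<le> \<gamma> * L n" using n \<gamma> by (intro mult_left_mono) auto
        ultimately show ?thesis by (simp add: algebra_simps)
      qed
    qed (use km kM mn big in auto)
  qed
qed

text \<open>For \<open>A = D + 1\<close> the first factor is \<open>Q ^ D\<close>, with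
  \<open>Q\<close> the product of the first \<open>m\<close> denominators \<open>2 powr L j\<close>;
  the second factor bounds the remainder of the series. The two inequalities of the good window beat
  the two summands of the tail bound, one each.\<close>

lemma ex_small_tail:
  fixes L :: "nat \<Rightarrow> real" and \<kappa> \<epsilon> A \<delta> :: real
  assumes \<kappa>: "0 < \<kappa>" "\<kappa> < 1" and \<epsilon>: "\<epsilon> > 0" and A: "A \<ge> 2" and \<delta>: "\<delta> > 0"
    and mono: "mono L" and nonneg: "\<And>i. L i \<ge> 0"
    and lower: "eventually (\<lambda>i. L i \<ge> (1 + \<epsilon>) * log 2 (real i)) sequentially"
    and growth: "\<And>K. frequently (\<lambda>n. L n \<ge> K * A ^ n) sequentially"
  shows "\<exists>m\<ge>M. 2 powr ((A - 1) * (\<Sum>j<m. L j)) *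
           (\<Sum>i. 2 powr (L (i + m) powr \<kappa> - L (i + m))) \<le> \<delta>"
proof -
  obtain \<gamma> K M0 where \<gamma>: "0 < \<gamma>" and K: "0 < K"
    and tail: "\<And>m n. m \<ge> M0 \<Longrightarrow> n \<ge> m \<Longrightarrow> \<forall>i\<in>{m..n}. real i \<le> L i \<Longrightarrow>
      (\<Sum>i. 2 powr (L (i + m) powr \<kappa> - L (i + m)))
        \<le> K * (2 powr (2 * L m powr \<kappa> - L m) + 2 powr (- \<gamma> * L n))"
    using tail_bound(2)[OF \<kappa> \<epsilon> mono lower] unfolding eventually_sequentially by blast
  \<comment> \<open>Each of the two summands, multiplied by the first factor, will be at most
    \<open>2 powr (- W) = \<delta> / (2 * K)\<close>, so that together with the constant
    \<open>K\<close> they give \<delta>.\<close>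
  define W where "W = log 2 (2 * K / \<delta>)"
  have W: "2 powr (- W) = \<delta> / (2 * K)"
    using K \<delta> by (simp add: W_def powr_minus field_simps)
  obtain m n where m: "m \<ge> max M M0" and n: "n \<ge> m" "\<forall>i\<in>{m..n}. real i \<le> L i"
    and w1: "(A - 1) * (\<Sum>j<m. L j) + 2 * L m powr \<kappa> + W \<le> L m"
    and w2: "(A - 1) * (\<Sum>j<m. L j) + W \<le> \<gamma> * L n"
    using ex_good_window[OF \<kappa> A \<gamma> mono nonneg growth] by blast
  define H where "H = (A - 1) * (\<Sum>j<m. L j)"
  have "2 powr H * (\<Sum>i. 2 powr (L (i + m) powr \<kappa> - L (i + m)))
      \<le> 2 powr H * (K * (2 powr (2 * L m powr \<kappa> - L m) + 2 powr (- \<gamma> * L n)))"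
    using tail[of m n] m n by (intro mult_left_mono) auto
  also have "\<dots> = K * (2 powr (H + (2 * L m powr \<kappa> - L m)) + 2 powr (H + (- \<gamma> * L n)))"
    by (simp only: powr_add) (simp add: algebra_simps)
  also have "\<dots> \<le> K * (2 powr (- W) + 2 powr (- W))"
    using w1 w2 K by (intro mult_left_mono add_mono powr_mono) (auto simp: H_def)
  also have "\<dots> = \<delta>" using K by (simp add: W)
  finally show ?thesis using m unfolding H_def by auto
qed

section \<open>Powers of \<open>p\<close> in denominators\<close>

text \<open>This is the rational root theorem localized at \<open>p\<close>. After clearing
  denominators, every term except \<open>g D * u ^ D\<close> contains a factor
  \<open>p ^ V * w\<close>. The fraction may be reducible, since only coprimality of
  \<open>u\<close> and \<open>p\<close> is used to cancel \<open>u ^ D\<close>.\<close>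

lemma rational_root_prime_power_dvd:
  fixes g :: "nat \<Rightarrow> int" and p :: nat
  assumes p: "prime p" and u: "\<not> int p dvd u" and w: "w \<noteq> 0"
    and root: "(\<Sum>i\<le>D. real_of_int (g i) * (real_of_int u / (real p ^ V * real_of_int w)) ^ i) = 0"
  shows "int p ^ V dvd g D"
proof -
  define v where "v = int p ^ V * w"
  have p0: "p > 0" using p by (simp add: prime_gt_0_nat)
  have v: "real_of_int v = real p ^ V * real_of_int w" "v \<noteq> 0" using w p0 by (auto simp: v_def)
  have "(\<Sum>i\<le>D. real_of_int (g i) * real_of_int u ^ i * real_of_int v ^ (D - i))
      = real_of_int v ^ D * (\<Sum>i\<le>D. real_of_int (g i) * (real_of_int u / real_of_int v) ^ i)"
    unfolding sum_distrib_left
  proof (rule sum.cong)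
    fix i assume "i \<in> {..D}"
    hence "real_of_int v ^ D = real_of_int v ^ (D - i) * real_of_int v ^ i"
      by (simp add: power_add[symmetric])
    thus "real_of_int (g i) * real_of_int u ^ i * real_of_int v ^ (D - i)
      = real_of_int v ^ D * (real_of_int (g i) * (real_of_int u / real_of_int v) ^ i)"
      using v(2) by (simp add: power_divide)
  qed simp
  also have "\<dots> = 0" using root by (simp add: v)
  finally have "real_of_int (\<Sum>i\<le>D. g i * u ^ i * v ^ (D - i)) = 0" by simp
  hence eq: "(\<Sum>i\<le>D. g i * u ^ i * v ^ (D - i)) = 0" by (simp only: of_int_eq_0_iff)
  have "(\<Sum>i\<le>D. g i * u ^ i * v ^ (D - i)) = (\<Sum>i<D. g i * u ^ i * v ^ (D - i)) + g D * u ^ D"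
    by (simp add: lessThan_Suc_atMost[symmetric])
  moreover have "v dvd (\<Sum>i<D. g i * u ^ i * v ^ (D - i))"
    by (intro dvd_sum dvd_mult dvd_power) auto
  ultimately have "v dvd g D * u ^ D"
    using eq by (metis add.inverse_unique dvd_minus_iff add_eq_0_iff)
  hence "int p ^ V dvd g D * u ^ D" unfolding v_def by (rule dvd_mult_left)
  moreover have "coprime (int p ^ V) (u ^ D)"
    using u p by (simp add: prime_imp_coprime)
  ultimately show ?thesis by (simp add: coprime_dvd_mult_left_iff)
qed

text \<open>This is the ultrametric principle. Multiplied by \<open>p ^ V\<close>, where
  \<open>V\<close> is the maximal multiplicity, the \<open>j\<close>-th fraction becomes a
  \<open>p\<close>-adic unit while all others become divisible by \<open>p\<close>, so the whole sum
  becomes a unit.\<close>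

lemma sum_unique_max_multiplicity:
  fixes J :: "'a set" and \<alpha> \<beta> :: "'a \<Rightarrow> int" and p :: nat
  assumes p: "prime p" and J: "finite J" "j \<in> J" and nz: "\<And>i. i \<in> J \<Longrightarrow> \<alpha> i \<noteq> 0"
    and max: "\<And>i. i \<in> J \<Longrightarrow> i \<noteq> j \<Longrightarrow> multiplicity (int p) (\<alpha> i) < multiplicity (int p) (\<alpha> j)"
    and \<beta>: "\<not> int p dvd \<beta> j"
  obtains u w :: int where "\<not> int p dvd u" "w \<noteq> 0"
    "(\<Sum>i\<in>J. real_of_int (\<beta> i) / real_of_int (\<alpha> i))
       = real_of_int u / (real p ^ multiplicity (int p) (\<alpha> j) * real_of_int w)"
proof -
  define V where "V = multiplicity (int p) (\<alpha> j)"
  have p': "prime (int p)" using p by simp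
  have p0: "real p > 0" using p by (simp add: prime_gt_0_nat)
  have dec: "\<exists>y. \<not> int p dvd y \<and> \<alpha> i = int p ^ multiplicity (int p) (\<alpha> i) * y" if "i \<in> J" for i
    using multiplicity_decompose'[of "\<alpha> i" "int p"] nz[OF that] p' by (metis not_prime_unit)
  \<comment> \<open>Membership in the maximal ideal of the localization at \<open>p\<close> is
    expressed by an explicit fraction \<open>p * u / w\<close> with \<open>w\<close> prime to
    \<open>p\<close>, a form preserved under addition.\<close>
  have "\<exists>u w. \<not> int p dvd w \<and>
      real p ^ V * (\<Sum>i\<in>I. real_of_int (\<beta> i) / real_of_int (\<alpha> i)) = real p * real_of_int u / real_of_int w"
    if "finite I" "I \<subseteq> J - {j}" for I
    using that
  proof (induction I rule: finite_induct)
    case empty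
    show ?case using p' by (intro exI[of _ 0] exI[of _ 1]) (auto simp: not_prime_unit)
  next
    case (insert i I)
    then obtain u w where uw: "\<not> int p dvd w"
      "real p ^ V * (\<Sum>i\<in>I. real_of_int (\<beta> i) / real_of_int (\<alpha> i)) = real p * real_of_int u / real_of_int w"
      by blast
    have i: "i \<in> J" "i \<noteq> j" using insert by auto
    obtain y where y: "\<not> int p dvd y" "\<alpha> i = int p ^ multiplicity (int p) (\<alpha> i) * y"
      using dec[OF i(1)] by blast
    obtain t where t: "V = Suc (multiplicity (int p) (\<alpha> i) + t)"
      using max[OF i] less_iff_Suc_add V_def by metis
    have "real_of_int (\<alpha> i) = real p ^ multiplicity (int p) (\<alpha> i) * real_of_int y"
      by (subst y(2)) simp
    hence "real p ^ V * (real_of_int (\<beta> i) / real_of_int (\<alpha> i)) = real p * (real p ^ t * real_of_int (\<beta> i)) / real_of_int y"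
      using p0 by (simp add: t power_add)
    moreover have "w \<noteq> 0" "y \<noteq> 0" using uw y by auto
    ultimately have "real p ^ V * (\<Sum>i\<in>insert i I. real_of_int (\<beta> i) / real_of_int (\<alpha> i))
       = real p * real_of_int (int p ^ t * \<beta> i * w + u * y) / real_of_int (w * y)"
      using insert uw(2) by (simp add: distrib_left add_divide_distrib)
    moreover have "\<not> int p dvd w * y" using uw y p' by (simp add: prime_dvd_mult_iff)
    ultimately show ?case by blast
  qed
  from this[of "J - {j}"] obtain u w where uw: "\<not> int p dvd w"
      "real p ^ V * (\<Sum>i\<in>J - {j}. real_of_int (\<beta> i) / real_of_int (\<alpha> i)) = real p * real_of_int u / real_of_int w"
    using J by blast
  obtain y where y: "\<not> int p dvd y" "\<alpha> j = int p ^ V * y"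
    using dec[OF J(2)] unfolding V_def by blast
  have nz': "w \<noteq> 0" "y \<noteq> 0" using uw y by auto
  have "real p ^ V * (\<Sum>i\<in>J. real_of_int (\<beta> i) / real_of_int (\<alpha> i))
      = real_of_int (\<beta> j) / real_of_int y + real p * real_of_int u / real_of_int w"
    using J p0 uw(2) by (simp add: sum.remove distrib_left y(2))
  also have "\<dots> = real_of_int (\<beta> j * w + int p * u * y) / real_of_int (w * y)"
    using nz' by (simp add: field_simps)
  finally have eq: "(\<Sum>i\<in>J. real_of_int (\<beta> i) / real_of_int (\<alpha> i))
      = real_of_int (\<beta> j * w + int p * u * y) / (real p ^ V * real_of_int (w * y))"
    using p0 nz' by (simp add: field_simps)
  have "\<not> int p dvd \<beta> j * w"
    using \<beta> uw p' by (simp add: prime_dvd_mult_iff)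
  hence "\<not> int p dvd \<beta> j * w + int p * u * y"
    by (metis dvd_add_left_iff dvd_triv_left mult.assoc)
  thus thesis by (rule that[OF _ _ eq[unfolded V_def]]) (use nz' in simp)
qed

section \<open>Values of integer polynomials near a root\<close>

text \<open>Multiplication by \<open>Q ^ degree f\<close> turns the value into a nonzero integer,
  which has absolute value at least 1.\<close>

lemma int_poly_value_lower_bound:
  fixes f :: "real poly" and P :: int and Q :: nat
  assumes "\<And>i. coeff f i \<in> \<int>" and Q: "Q > 0" and nz: "poly f (real_of_int P / real Q) \<noteq> 0"
  shows "\<bar>poly f (real_of_int P / real Q)\<bar> \<ge> 1 / real Q ^ degree f"
proof -
  let ?D = "degree f"
  have eq: "real Q ^ ?D * poly f (real_of_int P / real Q)
      = (\<Sum>i\<le>?D. coeff f i * real_of_int P ^ i * real Q ^ (?D - i))"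
    unfolding poly_altdef sum_distrib_left
  proof (rule sum.cong)
    fix i assume "i \<in> {..?D}"
    hence "real Q ^ ?D = real Q ^ (?D - i) * real Q ^ i"
      by (simp add: power_add[symmetric])
    thus "real Q ^ ?D * (coeff f i * (real_of_int P / real Q) ^ i)
       = coeff f i * real_of_int P ^ i * real Q ^ (?D - i)"
      using Q by (simp add: power_divide)
  qed simp
  have "real Q ^ ?D * poly f (real_of_int P / real Q) \<in> \<int>"
    unfolding eq using assms(1) by (intro Ints_sum Ints_mult Ints_power) auto
  moreover have "real Q ^ ?D * poly f (real_of_int P / real Q) \<noteq> 0" using nz Q by simp
  ultimately have "\<bar>real Q ^ ?D * poly f (real_of_int P / real Q)\<bar> \<ge> 1"
    by (rule Ints_nonzero_abs_ge1)
  thus ?thesis using Q by (simp add: abs_mult field_simps)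
qed

text \<open>Split off the linear factor belonging to the root; the cofactor is bounded on the
  compact ball of radius 1.\<close>

lemma poly_root_lipschitz:
  fixes f :: "real poly"
  assumes "poly f x = 0"
  obtains K where "K > 0" "\<And>y. \<bar>y - x\<bar> \<le> 1 \<Longrightarrow> \<bar>poly f y\<bar> \<le> K * \<bar>y - x\<bar>"
proof -
  obtain q where q: "f = [:-x, 1:] * q" using assms by (auto simp: poly_eq_0_iff_dvd)
  have "compact ((\<lambda>y. poly q y) ` cball x 1)"
    by (intro compact_continuous_image continuous_intros) auto
  then obtain K where K: "K > 0" "\<And>y. y \<in> cball x 1 \<Longrightarrow> \<bar>poly q y\<bar> \<le> K"
    by (metis (no_types, lifting) bounded_pos compact_imp_bounded image_eqI real_norm_def)
  show thesis
  proof (rule that[OF K(1)])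
    fix y assume "\<bar>y - x\<bar> \<le> 1"
    hence "\<bar>poly q y\<bar> \<le> K" by (intro K) (simp add: dist_real_def abs_minus_commute)
    hence "\<bar>y - x\<bar> * \<bar>poly q y\<bar> \<le> \<bar>y - x\<bar> * K" by (intro mult_left_mono) auto
    moreover have "poly f y = (y - x) * poly q y" by (simp add: q algebra_simps)
    ultimately show "\<bar>poly f y\<bar> \<le> K * \<bar>y - x\<bar>" by (simp add: abs_mult mult.commute)
  qed
qed

section \<open>Common denominators and rearrangement\<close>

text \<open>The full product serves as denominator, not the least common multiple: its logarithm is
  the sum of the single logarithms, which is what the growth estimates control.\<close>

lemma sum_fractions_common_denominator:
  fixes \<beta> \<alpha> :: "'a \<Rightarrow> int"
  assumes "finite I" "\<And>i. i \<in> I \<Longrightarrow> \<alpha> i \<noteq> 0"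
  shows "\<exists>P::int. (\<Sum>i\<in>I. real_of_int (\<beta> i) / real_of_int (\<alpha> i)) = real_of_int P / real (\<Prod>i\<in>I. nat \<bar>\<alpha> i\<bar>)"
  using assms
proof (induction I rule: finite_induct)
  case empty
  show ?case by (intro exI[of _ 0]) simp
next
  case (insert i I)
  define Q where "Q = (\<Prod>i\<in>I. nat \<bar>\<alpha> i\<bar>)"
  obtain P where P: "(\<Sum>i\<in>I. real_of_int (\<beta> i) / real_of_int (\<alpha> i)) = real_of_int P / real Q"
    using insert unfolding Q_def by blast
  have Q: "Q \<noteq> 0" using insert by (auto simp: Q_def)
  have \<alpha>: "\<alpha> i \<noteq> 0" using insert by simp
  have "real_of_int (\<beta> i) / real_of_int (\<alpha> i) = real_of_int (sgn (\<alpha> i) * \<beta> i) / real (nat \<bar>\<alpha> i\<bar>)"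
    using \<alpha> by (cases "\<alpha> i > 0") (auto simp: sgn_if)
  hence "(\<Sum>i\<in>insert i I. real_of_int (\<beta> i) / real_of_int (\<alpha> i))
     = real_of_int (sgn (\<alpha> i) * \<beta> i) / real (nat \<bar>\<alpha> i\<bar>) + real_of_int P / real Q"
    using insert P by simp
  also have "\<dots> = real_of_int (sgn (\<alpha> i) * \<beta> i * int Q + P * \<bar>\<alpha> i\<bar>) / real (nat \<bar>\<alpha> i\<bar> * Q)"
    using \<alpha> Q by (simp add: field_simps)
  also have "nat \<bar>\<alpha> i\<bar> * Q = (\<Prod>i\<in>insert i I. nat \<bar>\<alpha> i\<bar>)"
    using insert by (simp add: Q_def)
  finally show ?case by blast
qed

text \<open>Absolute convergence makes the sum unconditional and hence invariant under bijections.
  It is assumed for the rearranged series because the bounds are available in sorted order.\<close>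

lemma sums_reindex_bij:
  fixes t :: "nat \<Rightarrow> real"
  assumes "bij \<sigma>" "summable (\<lambda>k. \<bar>t (\<sigma> k)\<bar>)"
  shows "summable t" "(\<lambda>k. t (\<sigma> k)) sums (\<Sum>n. t n)"
proof -
  have s: "summable (\<lambda>k. t (\<sigma> k))" using assms(2) by (rule summable_rabs_cancel)
  hence "((\<lambda>k. t (\<sigma> k)) has_sum (\<Sum>k. t (\<sigma> k))) UNIV"
    using assms(2) by (intro norm_summable_imp_has_sum) (auto simp: summable_sums)
  hence "(t has_sum (\<Sum>k. t (\<sigma> k))) UNIV"
    using has_sum_reindex_bij_betw[of \<sigma> UNIV UNIV t] assms(1) by simp
  hence "t sums (\<Sum>k. t (\<sigma> k))" by (rule has_sum_imp_sums)
  thus "summable t" "(\<lambda>k. t (\<sigma> k)) sums (\<Sum>n. t n)"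
    using s by (auto simp: sums_iff)
qed

section \<open>The sum is not a root of an integer polynomial\<close>

text \<open>This is the common core of both conclusions. The growth condition is tied to
  \<open>degree f\<close>, so that linear polynomials, which decide irrationality, only need growth
  beyond every multiple of \<open>2 ^ n\<close>.\<close>

lemma series_not_root:
  fixes p C :: nat and \<epsilon> \<kappa> :: real and \<alpha> \<beta> c :: "nat \<Rightarrow> int"
  assumes p: "prime p" and \<epsilon>: "\<epsilon> > 0" and \<kappa>: "\<kappa> > 0" "\<kappa> < 1"
    and nz: "\<And>n. \<alpha> n \<noteq> 0" and gcd: "\<And>n. \<not> int p dvd gcd (\<alpha> n) (\<beta> n)"
    and unbounded: "\<And>V. \<exists>n. multiplicity (int p) (\<alpha> n) > V"
    and distinct: "\<And>m n. m \<noteq> n \<Longrightarrow> multiplicity (int p) (\<alpha> m) = multiplicity (int p) (\<alpha> n) \<Longrightarrow>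
                     multiplicity (int p) (\<alpha> n) \<le> C"
    and ev_\<alpha>: "eventually (\<lambda>n. \<alpha> (Suc n) \<ge> \<alpha> n \<and> real_of_int (\<alpha> n) \<ge> real n powr (1 + \<epsilon>)) sequentially"
    and ev_\<beta>: "eventually (\<lambda>n. real_of_int \<bar>\<beta> n\<bar> \<le> 2 powr ((log 2 \<bar>\<alpha> n\<bar>) powr \<kappa>)) sequentially"
    and c: "\<And>n. \<not> int p dvd c n"
  defines "t \<equiv> \<lambda>n. real_of_int (\<beta> n) / real_of_int (\<alpha> n * c n)"
  shows "summable t"
    and "\<And>f. (\<And>i. coeff f i \<in> \<int>) \<Longrightarrow> degree f > 0 \<Longrightarrow>
           (\<And>K. frequently (\<lambda>n. log 2 (real_of_int (\<alpha> n)) \<ge> K * real (degree f + 1) ^ n) sequentially) \<Longrightarrow>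
           poly f (\<Sum>n. t n) \<noteq> 0"
proof -
  have c0: "c n \<noteq> 0" for n using c[of n] by auto
  have nz': "\<alpha> n * c n \<noteq> 0" for n using nz c0 by simp
  define d where "d n = nat \<bar>\<alpha> n * c n\<bar>" for n
  have d_pos: "d n > 0" for n using nz'[of n] by (simp add: d_def)
  have d_real: "real (d n) = \<bar>real_of_int (\<alpha> n * c n)\<bar>" for n by (simp add: d_def)
  have d_ge: "\<bar>real_of_int (\<alpha> n)\<bar> \<le> real (d n)" for n
  proof -
    have "\<bar>\<alpha> n\<bar> * 1 \<le> \<bar>\<alpha> n\<bar> * \<bar>c n\<bar>" using c0[of n] by (intro mult_left_mono) auto
    hence "\<bar>\<alpha> n\<bar> \<le> int (d n)" by (simp add: d_def abs_mult)
    thus ?thesis by linarith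
  qed
  obtain N where N: "\<And>n. n \<ge> N \<Longrightarrow> \<alpha> (Suc n) \<ge> \<alpha> n"
      "\<And>n. n \<ge> N \<Longrightarrow> real_of_int (\<alpha> n) \<ge> real n powr (1 + \<epsilon>)"
    and N\<beta>: "\<And>n. n \<ge> N \<Longrightarrow> real_of_int \<bar>\<beta> n\<bar> \<le> 2 powr ((log 2 \<bar>\<alpha> n\<bar>) powr \<kappa>)"
    using eventually_conj[OF ev_\<alpha> ev_\<beta>] unfolding eventually_sequentially by blast
  have \<alpha>_mono: "\<alpha> m \<le> \<alpha> n" if "N \<le> m" "m \<le> n" for m n
    using that(2)
  proof (induction n rule: dec_induct)
    case (step n)
    thus ?case using N(1)[of n] that(1) by simp
  qed simp
  have fin: "finite {n. d n \<le> T}" for T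
  proof (rule finite_subset)
    show "{n. d n \<le> T} \<subseteq> {..max (Suc N) T}"
    proof
      fix n assume n: "n \<in> {n. d n \<le> T}"
      show "n \<in> {..max (Suc N) T}"
      proof (cases "n \<le> Suc N")
        case False
        have "real n powr 1 \<le> real n powr (1 + \<epsilon>)" using False \<epsilon> by (intro powr_mono) auto
        also have "\<dots> \<le> real (d n)" using N(2)[of n] d_ge[of n] False by linarith
        finally have "n \<le> d n" using False by simp
        thus ?thesis using n by simp
      qed auto
    qed
  qed simp
  \<comment> \<open>The factors \<open>c n\<close> are arbitrary, so \<open>d\<close> need not be
    monotone; sorting provides the monotonicity of \<open>L\<close> on which the tail bounds
    rest.\<close>
  obtain \<sigma> :: "nat \<Rightarrow> nat" where \<sigma>: "bij \<sigma>" "mono (\<lambda>k. d (\<sigma> k))"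
    using ex_sorting_bij[OF fin] by blast
  have inj: "inj \<sigma>" using \<sigma>(1) by (rule bij_is_inj)
  define L where "L k = log 2 (real (d (\<sigma> k)))" for k
  have L_nonneg: "L k \<ge> 0" for k using d_pos[of "\<sigma> k"] by (simp add: L_def Suc_le_eq)
  have L_mono: "mono L"
    unfolding L_def using d_pos \<sigma>(2) by (auto intro!: monoI dest: monoD)
  have powr_L: "2 powr L k = real (d (\<sigma> k))" for k using d_pos[of "\<sigma> k"] by (simp add: L_def)
  have e_ge: "real_of_int (\<alpha> k) \<le> real (d (\<sigma> k))" if "k \<ge> N" for k
  proof -
    \<comment> \<open>By the pigeonhole principle the \<open>k + 1\<close> distinct values of
      \<sigma> on \<open>{..k}\<close> cannot all lie below \<open>k\<close>. This transfers the
      growth of \<alpha> to the sorted denominators.\<close>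
    have "\<exists>i\<le>k. \<sigma> i \<ge> k"
    proof (rule ccontr)
      assume "\<not> (\<exists>i\<le>k. \<sigma> i \<ge> k)"
      hence "\<sigma> ` {..k} \<subseteq> {..<k}" by force
      hence "card (\<sigma> ` {..k}) \<le> card {..<k}" by (rule card_mono[rotated]) simp
      thus False by (simp add: card_image inj_on_subset[OF inj])
    qed
    then obtain i where i: "i \<le> k" "\<sigma> i \<ge> k" by blast
    have "real_of_int (\<alpha> k) \<le> \<bar>real_of_int (\<alpha> (\<sigma> i))\<bar>" using \<alpha>_mono[OF that i(2)] by linarith
    also have "\<dots> \<le> real (d (\<sigma> i))" by (rule d_ge)
    also have "\<dots> \<le> real (d (\<sigma> k))" using monoD[OF \<sigma>(2) i(1)] by simp
    finally show ?thesis .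
  qed
  have \<alpha>_pos: "\<alpha> k > 0" if "k \<ge> N" "k > 0" for k
  proof -
    have "real k powr (1 + \<epsilon>) > 0" using that by simp
    thus ?thesis using N(2)[OF that(1)] by linarith
  qed
  have L_ge: "log 2 (real_of_int (\<alpha> k)) \<le> L k" if "k \<ge> N" "k > 0" for k
    unfolding L_def using \<alpha>_pos[OF that] e_ge[OF that(1)] d_pos[of "\<sigma> k"] by simp
  have lower: "eventually (\<lambda>k. L k \<ge> (1 + \<epsilon>) * log 2 (real k)) sequentially"
    using eventually_ge_at_top[of "Suc N"]
  proof eventually_elim
    case (elim k)
    have "(1 + \<epsilon>) * log 2 (real k) = log 2 (real k powr (1 + \<epsilon>))"
      using elim by (simp add: log_powr)
    also have "\<dots> \<le> log 2 (real_of_int (\<alpha> k))"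
      using N(2)[of k] \<alpha>_pos[of k] elim by simp
    also have "\<dots> \<le> L k" using elim by (intro L_ge) auto
    finally show ?case .
  qed
  define F where "F k = 2 powr (L k powr \<kappa> - L k)" for k
  have F_summable: "summable F"
    unfolding F_def by (rule tail_bound(1)[OF \<kappa> \<epsilon> L_mono lower])
  have t_le: "\<bar>t n\<bar> \<le> 2 powr (log 2 (real (d n)) powr \<kappa> - log 2 (real (d n)))" if "n \<ge> N" for n
  proof -
    have "\<bar>real_of_int (\<alpha> n)\<bar> \<ge> 1" using nz[of n] by linarith
    hence "log 2 \<bar>real_of_int (\<alpha> n)\<bar> powr \<kappa> \<le> log 2 (real (d n)) powr \<kappa>"
      using d_ge[of n] d_pos[of n] \<kappa> by (intro powr_mono2) auto
    hence "2 powr (log 2 \<bar>real_of_int (\<alpha> n)\<bar> powr \<kappa>) \<le> 2 powr (log 2 (real (d n)) powr \<kappa>)"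
      by (intro powr_mono) auto
    moreover have "\<bar>real_of_int (\<beta> n)\<bar> \<le> 2 powr (log 2 \<bar>real_of_int (\<alpha> n)\<bar> powr \<kappa>)"
      using N\<beta>[OF that] by simp
    ultimately have "\<bar>real_of_int (\<beta> n)\<bar> \<le> 2 powr (log 2 (real (d n)) powr \<kappa>)" by linarith
    hence "\<bar>real_of_int (\<beta> n)\<bar> / real (d n) \<le> 2 powr (log 2 (real (d n)) powr \<kappa>) / real (d n)"
      by (intro divide_right_mono) auto
    moreover have "\<bar>t n\<bar> = \<bar>real_of_int (\<beta> n)\<bar> / real (d n)" by (simp add: t_def d_real)
    ultimately show ?thesis using d_pos[of n] by (simp add: powr_diff)
  qed
  \<comment> \<open>Only finitely many positions are occupied by indices below \<open>N\<close>,
    where the bound on \<beta> may fail.\<close>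
  obtain M where M: "\<And>k. k \<ge> M \<Longrightarrow> \<bar>t (\<sigma> k)\<bar> \<le> F k"
  proof -
    have "finite (\<sigma> -` {..<N})" by (rule finite_vimageI[OF _ inj]) simp
    then obtain M where M: "\<forall>k\<in>\<sigma> -` {..<N}. k < M"
      unfolding finite_nat_set_iff_bounded by blast
    show thesis
    proof (rule that[of M])
      fix k assume k: "k \<ge> M"
      have "\<sigma> k \<ge> N"
      proof (rule ccontr)
        assume "\<not> \<sigma> k \<ge> N"
        hence "k \<in> \<sigma> -` {..<N}" by simp
        with M have "k < M" by blast
        with k show False by simp
      qed
      thus "\<bar>t (\<sigma> k)\<bar> \<le> F k" using t_le[of "\<sigma> k"] by (simp add: F_def L_def)
    qed
  qed
  have abs_summable: "summable (\<lambda>k. \<bar>t (\<sigma> k)\<bar>)"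
    by (rule summable_comparison_test[OF _ F_summable]) (use M in auto)
  note reindex = sums_reindex_bij[OF \<sigma>(1) abs_summable]
  show "summable t" by (rule reindex(1))

  fix f :: "real poly"
  assume f: "\<And>i. coeff f i \<in> \<int>" "degree f > 0"
    and growth: "\<And>K. frequently (\<lambda>n. log 2 (real_of_int (\<alpha> n)) \<ge> K * real (degree f + 1) ^ n) sequentially"
  define x where "x = (\<Sum>n. t n)"
  show "poly f (\<Sum>n. t n) \<noteq> 0"
  proof
    assume "poly f (\<Sum>n. t n) = 0"
    then obtain K where K: "K > 0" "\<And>y. \<bar>y - x\<bar> \<le> 1 \<Longrightarrow> \<bar>poly f y\<bar> \<le> K * \<bar>y - x\<bar>"
      using poly_root_lipschitz[of f x] by (auto simp: x_def)
    define g where "g i = \<lfloor>coeff f i\<rfloor>" for i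
    have g: "coeff f i = real_of_int (g i)" for i
      using f(1)[of i] by (auto simp: g_def elim!: Ints_cases)
    define D where "D = degree f"
    have gD: "g D \<noteq> 0" using g[of D] f(2) by (auto simp: D_def)
    \<comment> \<open>Exceeding \<open>C\<close> will make the maximal valuation unique; exceeding
      the size of the leading coefficient will give the contradiction.\<close>
    obtain n0 where n0: "multiplicity (int p) (\<alpha> n0) > max C (nat \<bar>g D\<bar>)" using unbounded by blast
    have growth': "frequently (\<lambda>n. L n \<ge> K * real (D + 1) ^ n) sequentially" for K
      using frequently_eventually_frequently[OF growth[of K] eventually_ge_at_top[of "Suc N"]]
    proof (rule frequently_elim1, elim conjE)
      fix n assume "K * real (degree f + 1) ^ n \<le> log 2 (real_of_int (\<alpha> n))" "Suc N \<le> n"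
      thus "K * real (D + 1) ^ n \<le> L n" using L_ge[of n] unfolding D_def by linarith
    qed
    \<comment> \<open>The bound 1 keeps \<open>S\<close> in the ball where the Lipschitz estimate
      holds; the bound \<open>1 / (2 * K)\<close> gives at most \<open>1 / 2\<close> for
      \<open>Q ^ D\<close> times the absolute value of \<open>poly f S\<close>.\<close>
    define \<delta> where "\<delta> = min 1 (1 / (2 * K))"
    have \<delta>: "\<delta> > 0" using K by (simp add: \<delta>_def)
    \<comment> \<open>Taking \<open>m\<close> beyond the position of \<open>n0\<close> puts
      \<open>n0\<close> among the indices of the partial sum.\<close>
    obtain m where m: "m \<ge> max M (Suc (inv \<sigma> n0))"
      and small: "2 powr ((real (D + 1) - 1) * (\<Sum>j<m. L j)) * (\<Sum>i. F (i + m)) \<le> \<delta>"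
      using ex_small_tail[OF \<kappa> \<epsilon> _ \<delta> L_mono L_nonneg lower growth', of "max M (Suc (inv \<sigma> n0))"] f(2)
      unfolding F_def D_def by auto
    define S where "S = (\<Sum>k<m. t (\<sigma> k))"
    define J where "J = \<sigma> ` {..<m}"
    have J: "finite J" by (simp add: J_def)
    have S_J: "S = (\<Sum>n\<in>J. real_of_int (\<beta> n) / real_of_int (\<alpha> n * c n))"
      unfolding S_def J_def t_def by (simp add: sum.reindex inj_on_subset[OF inj])
    define Q where "Q = (\<Prod>n\<in>J. d n)"
    have Q: "Q > 0" using d_pos by (auto simp: Q_def prod_pos)
    obtain P where P: "S = real_of_int P / real Q"
      using sum_fractions_common_denominator[OF J, of "\<lambda>n. \<alpha> n * c n" \<beta>] nz'
      unfolding S_J Q_def d_def by blast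
    have "2 powr (\<Sum>j<m. L j) = (\<Prod>j<m. real (d (\<sigma> j)))"
      by (simp add: powr_sum powr_L)
    also have "\<dots> = real Q" unfolding Q_def J_def by (simp add: prod.reindex inj_on_subset[OF inj])
    finally have Q_powr: "2 powr (\<Sum>j<m. L j) = real Q" .
    have "2 powr ((real (D + 1) - 1) * (\<Sum>j<m. L j)) = (2 powr (\<Sum>j<m. L j)) powr real D"
      by (simp add: powr_powr mult.commute)
    also have "\<dots> = real Q ^ D" using Q by (simp add: Q_powr powr_realpow)
    finally have "2 powr ((real (D + 1) - 1) * (\<Sum>j<m. L j)) = real Q ^ D" .
    with small have small': "real Q ^ D * (\<Sum>i. F (i + m)) \<le> \<delta>" by simp
    have "\<bar>S - x\<bar> \<le> (\<Sum>i. F (i + m))"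
    proof -
      have "x - S = (\<Sum>i. t (\<sigma> (i + m)))"
        using suminf_minus_initial_segment[OF sums_summable[OF reindex(2)], of m] sums_unique[OF reindex(2)]
        by (simp add: x_def S_def)
      moreover have "\<bar>\<Sum>i. t (\<sigma> (i + m))\<bar> \<le> (\<Sum>i. \<bar>t (\<sigma> (i + m))\<bar>)"
        by (rule summable_rabs) (rule summable_ignore_initial_segment[OF abs_summable])
      moreover have "(\<Sum>i. \<bar>t (\<sigma> (i + m))\<bar>) \<le> (\<Sum>i. F (i + m))"
      proof (rule suminf_le)
        show "\<bar>t (\<sigma> (i + m))\<bar> \<le> F (i + m)" for i using m by (intro M) auto
      qed (rule summable_ignore_initial_segment[OF abs_summable],
           rule summable_ignore_initial_segment[OF F_summable])
      ultimately show ?thesis by linarith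
    qed
    hence "real Q ^ D * \<bar>S - x\<bar> \<le> real Q ^ D * (\<Sum>i. F (i + m))" by (intro mult_left_mono) auto
    with small' have close: "real Q ^ D * \<bar>S - x\<bar> \<le> \<delta>" by linarith
    have "1 * \<bar>S - x\<bar> \<le> real Q ^ D * \<bar>S - x\<bar>" using Q by (intro mult_right_mono) (auto simp: Suc_le_eq)
    with close have "\<bar>S - x\<bar> \<le> 1" by (simp add: \<delta>_def)
    hence "\<bar>poly f S\<bar> \<le> K * \<bar>S - x\<bar>" by (rule K(2))
    hence "real Q ^ D * \<bar>poly f S\<bar> \<le> real Q ^ D * (K * \<bar>S - x\<bar>)" by (intro mult_left_mono) auto
    also have "\<dots> = K * (real Q ^ D * \<bar>S - x\<bar>)" by simp
    also have "\<dots> \<le> K * (1 / (2 * K))" using close K by (intro mult_left_mono) (auto simp: \<delta>_def)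
    also have "\<dots> < 1" using K by simp
    finally have "\<bar>poly f S\<bar> < 1 / real Q ^ D" using Q by (simp add: field_simps)
    \<comment> \<open>Liouville: a nonzero value at \<open>P / Q\<close> would be at least
      \<open>1 / Q ^ D\<close>.\<close>
    hence root: "poly f S = 0"
      using int_poly_value_lower_bound[OF f(1) Q, of P] unfolding P D_def by linarith
    define v where "v n = multiplicity (int p) (\<alpha> n)" for n
    have v': "multiplicity (int p) (\<alpha> n * c n) = v n" for n
      using p nz c0 c[of n] by (simp add: prime_elem_multiplicity_mult_distrib not_dvd_imp_multiplicity_0 v_def)
    have n0J: "n0 \<in> J"
      unfolding J_def using m by (intro image_eqI[of _ _ "inv \<sigma> n0"]) (auto simp: surj_f_inv_f bij_is_surj[OF \<sigma>(1)])
    obtain j where j: "j \<in> J" "v j = Max (v ` J)"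
      using Max_in[of "v ` J"] J n0J by (metis (no_types, lifting) empty_iff finite_imageI imageE image_is_empty)
    have v_le: "v n \<le> v j" if "n \<in> J" for n using j(2) J that by simp
    have vj: "v j > C" "v j > nat \<bar>g D\<bar>" using v_le[OF n0J] n0 by (auto simp: v_def)
    \<comment> \<open>As \<open>v j\<close> is positive, \<open>p\<close> divides
      \<open>\<alpha> j\<close>, and the gcd hypothesis then excludes \<open>p\<close> from
      \<open>\<beta> j\<close>.\<close>
    have "int p dvd \<alpha> j" using vj(1) by (metis v_def not_dvd_imp_multiplicity_0 not_less_zero)
    hence \<beta>j: "\<not> int p dvd \<beta> j" using gcd[of j] by simp
    \<comment> \<open>Two indices with the same valuation have valuation at most \<open>C\<close>,
      but \<open>v j > C\<close>.\<close>
    have max: "v n < v j" if "n \<in> J" "n \<noteq> j" for n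
      using v_le[OF that(1)] distinct[OF that(2)] vj(1) unfolding v_def by fastforce
    obtain u w where uw: "\<not> int p dvd u" "w \<noteq> 0" "S = real_of_int u / (real p ^ v j * real_of_int w)"
      using sum_unique_max_multiplicity[OF p J j(1), of "\<lambda>n. \<alpha> n * c n" \<beta>] nz' max \<beta>j
      unfolding S_J v' by blast
    have "int p ^ v j dvd g D"
      using rational_root_prime_power_dvd[OF p uw(1,2), of g "v j" D] root
      unfolding uw(3) by (simp add: poly_altdef g D_def)
    hence "int p ^ v j \<le> \<bar>g D\<bar>" using gD dvd_imp_le_int[of "g D" "int p ^ v j"] by simp
    \<comment> \<open>Thus \<open>p ^ v j\<close> exceeds the absolute value of the nonzero integer
      \<open>g D\<close> that it divides.\<close>
    moreover have "v j < p ^ v j" using prime_gt_Suc_0_nat[OF p] by (rule power_gt_expt)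
    hence "int (v j) < int p ^ v j" by (metis of_nat_less_iff of_nat_power)
    ultimately show False using vj(2) by linarith
  qed
qed

section \<open>From the growth hypotheses to irrationality and transcendence\<close>

lemma limsup_infinity_imp_frequently_gt:
  fixes h :: "nat \<Rightarrow> real"
  assumes "limsup (\<lambda>n. ereal (h n)) = \<infinity>"
  shows "frequently (\<lambda>n. h n > K) sequentially"
proof (rule ccontr)
  assume "\<not> ?thesis"
  hence "eventually (\<lambda>n. ereal (h n) \<le> ereal K) sequentially"
    by (simp add: not_frequently not_less)
  hence "limsup (\<lambda>n. ereal (h n)) \<le> ereal K" by (rule Limsup_bounded)
  thus False using assms by simp
qed

text \<open>The conclusion concerns the shifted sequence, because it is applied to
  \<open>a (Suc n)\<close>. Comparing index \<open>n = Suc k\<close> with \<open>A ^ k\<close> is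
  harmless, since \<open>A ^ k \<le> A ^ n\<close>.\<close>

lemma limsup_powr_imp_frequently_log_ge:
  fixes h :: "nat \<Rightarrow> real" and A :: real
  assumes lim: "limsup (\<lambda>n. ereal (h n powr (1 / A ^ n))) = \<infinity>"
    and A: "A \<ge> 1" and pos: "eventually (\<lambda>n. h n > 0) sequentially"
  shows "frequently (\<lambda>n. log 2 (h (Suc n)) \<ge> K * A ^ n) sequentially"
  unfolding frequently_sequentially
proof
  fix N
  \<comment> \<open>Nonnegativity is needed for \<open>K * A ^ k \<le> K' * A ^ n\<close>.\<close>
  define K' where "K' = max 0 K"
  have "frequently (\<lambda>n. h n powr (1 / A ^ n) > 2 powr K' \<and> (h n > 0 \<and> n \<ge> Suc N)) sequentially"
    by (rule frequently_eventually_frequently[OF limsup_infinity_imp_frequently_gt[OF lim]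
          eventually_conj[OF pos eventually_ge_at_top]])
  then obtain n where n: "h n powr (1 / A ^ n) > 2 powr K'" "h n > 0" "n \<ge> Suc N"
    by (auto dest: frequently_ex)
  then obtain k where k: "n = Suc k" "k \<ge> N" by (cases n) auto
  have "log 2 (2 powr K') < log 2 (h n powr (1 / A ^ n))" using n by (intro log_less) auto
  hence "K' < log 2 (h n) / A ^ n" using n by (simp add: log_powr)
  hence "K' * A ^ n < log 2 (h n)" using A by (simp add: field_simps)
  moreover have "K * A ^ k \<le> K' * A ^ n"
    using A by (intro mult_mono power_increasing) (auto simp: K'_def k)
  ultimately show "\<exists>n\<ge>N. log 2 (h (Suc n)) \<ge> K * A ^ n" using k by force
qed

theorem theorem4:
  fixes p C :: nat and \<epsilon> \<kappa> :: real and a b :: "nat \<Rightarrow> int"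
  assumes "prime p" and "C > 0" and "\<epsilon> > 0" and "\<kappa> > 0" and "\<kappa> < 1"
    and "\<forall>n\<ge>1. a n \<noteq> 0 \<and> b n \<noteq> 0"
    and "\<forall>n\<ge>1. \<not> int p dvd gcd (a n) (b n)"
    and "limsup (\<lambda>n. ereal (real (multiplicity (int p) (a n)))) = \<infinity>"
    and "\<forall>m\<ge>1. \<forall>n\<ge>1. m \<noteq> n \<longrightarrow>
           multiplicity (int p) (a m) \<noteq> multiplicity (int p) (a n) \<or>
           (multiplicity (int p) (a m) = multiplicity (int p) (a n) \<and>
            multiplicity (int p) (a n) \<le> C)"
    and "eventually (\<lambda>n. a (Suc n) \<ge> a n \<and> real_of_int (a n) \<ge> real n powr (1 + \<epsilon>))
           sequentially"
    and "eventually (\<lambda>n. real_of_int \<bar>b n\<bar> \<le> 2 powr ((log 2 \<bar>a n\<bar>) powr \<kappa>))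
           sequentially"
  shows "(limsup (\<lambda>n. ereal (\<bar>real_of_int (a n)\<bar> powr (1 / 2 ^ n))) = \<infinity>
            \<longrightarrow> p_irrational p (\<lambda>n. real_of_int (a n) / real_of_int (b n)))
       \<and> ((\<forall>A::nat. A > 0 \<longrightarrow>
              limsup (\<lambda>n. ereal (real_of_int (a n) powr (1 / real A ^ n))) = \<infinity>)
            \<longrightarrow> p_transcendental p (\<lambda>n. real_of_int (a n) / real_of_int (b n)))"
proof -
  \<comment> \<open>The shift removes index 0, where nothing is known about \<open>a\<close> and
    \<open>b\<close>.\<close>
  define \<alpha> where "\<alpha> n = a (Suc n)" for n
  define \<beta> where "\<beta> n = b (Suc n)" for n
  have pos: "eventually (\<lambda>n. real_of_int (a n) > 0) sequentially"
    using assms(10) eventually_gt_at_top[of 0]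
  proof eventually_elim
    case (elim n)
    have "real n powr (1 + \<epsilon>) > 0" using elim by simp
    thus ?case using elim by linarith
  qed
  have unbounded: "\<exists>n. multiplicity (int p) (\<alpha> n) > V" for V
  proof -
    have "frequently (\<lambda>n. real (multiplicity (int p) (a n)) > real V \<and> n \<ge> 1) sequentially"
      by (rule frequently_eventually_frequently[OF limsup_infinity_imp_frequently_gt[OF assms(8)]
            eventually_ge_at_top])
    then obtain n where "multiplicity (int p) (a n) > V" "n \<ge> 1" by (auto dest: frequently_ex)
    thus ?thesis by (intro exI[of _ "n - 1"]) (simp add: \<alpha>_def)
  qed
  have ev_\<alpha>: "eventually (\<lambda>n. \<alpha> (Suc n) \<ge> \<alpha> n \<and> real_of_int (\<alpha> n) \<ge> real n powr (1 + \<epsilon>)) sequentially"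
    using assms(10)[THEN eventually_sequentially_Suc[THEN iffD2]]
  proof eventually_elim
    case (elim n)
    have "real n powr (1 + \<epsilon>) \<le> real (Suc n) powr (1 + \<epsilon>)"
      using assms(3) by (intro powr_mono2) auto
    thus ?case using elim by (auto simp: \<alpha>_def)
  qed
  have ev_\<beta>: "eventually (\<lambda>n. real_of_int \<bar>\<beta> n\<bar> \<le> 2 powr ((log 2 \<bar>\<alpha> n\<bar>) powr \<kappa>)) sequentially"
    using assms(11)[THEN eventually_sequentially_Suc[THEN iffD2]] by (simp add: \<alpha>_def \<beta>_def)
  have distinct: "multiplicity (int p) (\<alpha> n) \<le> C"
    if "m \<noteq> n" "multiplicity (int p) (\<alpha> m) = multiplicity (int p) (\<alpha> n)" for m n
    using assms(9)[rule_format, of "Suc m" "Suc n"] that by (auto simp: \<alpha>_def)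
  have nz: "\<alpha> n \<noteq> 0" and gcd: "\<not> int p dvd gcd (\<alpha> n) (\<beta> n)" for n
    using assms(6,7) by (auto simp: \<alpha>_def \<beta>_def)
  have ratio_nz: "\<forall>n\<ge>1. real_of_int (a n) / real_of_int (b n) \<noteq> 0"
    using assms(6) by simp
  have series: "(\<lambda>n. 1 / (real_of_int (a (Suc n)) / real_of_int (b (Suc n)) * of_int (c (Suc n))))
      = (\<lambda>n. real_of_int (\<beta> n) / real_of_int (\<alpha> n * c (Suc n)))" for c :: "nat \<Rightarrow> int"
    by (simp add: \<alpha>_def \<beta>_def)
  have summable: "summable (\<lambda>n. real_of_int (\<beta> n) / real_of_int (\<alpha> n * c (Suc n)))"
    if "\<And>n. \<not> int p dvd c (Suc n)" for c
    by (rule series_not_root(1)[OF assms(1,3,4,5) nz gcd unbounded _ ev_\<alpha> ev_\<beta> that])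
       (fact distinct)
  have not_root: "poly f (\<Sum>n. real_of_int (\<beta> n) / real_of_int (\<alpha> n * c (Suc n))) \<noteq> 0"
    if "\<And>n. \<not> int p dvd c (Suc n)" "\<And>i. coeff f i \<in> \<int>" "degree f > 0"
      "\<And>K. frequently (\<lambda>n. log 2 (real_of_int (\<alpha> n)) \<ge> K * real (degree f + 1) ^ n) sequentially"
    for c f
    by (rule series_not_root(2)[OF assms(1,3,4,5) nz gcd unbounded _ ev_\<alpha> ev_\<beta> that])
       (fact distinct)
  show ?thesis
  proof (intro conjI impI)
    assume lim: "limsup (\<lambda>n. ereal (\<bar>real_of_int (a n)\<bar> powr (1 / 2 ^ n))) = \<infinity>"
    \<comment> \<open>Here \<open>A = 2\<close> is the degree of a linear polynomial plus one. The
      absolute value disappears because \<open>a n\<close> is eventually positive.\<close>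
    have growth: "frequently (\<lambda>n. log 2 (real_of_int (\<alpha> n)) \<ge> K * 2 ^ n) sequentially" for K
    proof (rule frequently_elim1[OF frequently_eventually_frequently[OF
          limsup_powr_imp_frequently_log_ge[OF lim, of K]
          pos[THEN eventually_sequentially_Suc[THEN iffD2]]]])
      show "eventually (\<lambda>n. \<bar>real_of_int (a n)\<bar> > 0) sequentially"
        using pos by eventually_elim simp
    qed (auto simp: \<alpha>_def)
    show "p_irrational p (\<lambda>n. real_of_int (a n) / real_of_int (b n))"
      unfolding p_irrational_def series
    proof (intro conjI allI impI)
      fix c :: "nat \<Rightarrow> int" assume "\<forall>n\<ge>1. \<not> int p dvd c n"
      hence c: "\<not> int p dvd c (Suc n)" for n by simp
      show "summable (\<lambda>n. real_of_int (\<beta> n) / real_of_int (\<alpha> n * c (Suc n)))"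
        by (rule summable[of c, OF c])
      show "(\<Sum>n. real_of_int (\<beta> n) / real_of_int (\<alpha> n * c (Suc n))) \<notin> \<rat>"
      proof
        assume "(\<Sum>n. real_of_int (\<beta> n) / real_of_int (\<alpha> n * c (Suc n))) \<in> \<rat>"
        then obtain r s :: int where rs: "s > 0"
            "(\<Sum>n. real_of_int (\<beta> n) / real_of_int (\<alpha> n * c (Suc n))) = real_of_int r / real_of_int s"
          by (rule Rats_cases')
        \<comment> \<open>A rational value \<open>r / s\<close> would be a root of the linear
          polynomial \<open>s * X - r\<close>.\<close>
        have "poly [:- real_of_int r, real_of_int s:] (\<Sum>n. real_of_int (\<beta> n) / real_of_int (\<alpha> n * c (Suc n))) \<noteq> 0"
        proof (rule not_root[of c, OF c])
          show "coeff [:- real_of_int r, real_of_int s:] i \<in> \<int>" for i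
            by (auto simp: coeff_pCons split: nat.splits)
          show "degree [:- real_of_int r, real_of_int s:] > 0" using rs by simp
          show "frequently (\<lambda>n. K * real (degree [:- real_of_int r, real_of_int s:] + 1) ^ n
              \<le> log 2 (real_of_int (\<alpha> n))) sequentially" for K
            using growth[of K] rs by simp
        qed
        thus False using rs(1) unfolding rs(2) by simp
      qed
    qed (use ratio_nz in auto)
  next
    assume lim: "\<forall>A::nat. A > 0 \<longrightarrow>
              limsup (\<lambda>n. ereal (real_of_int (a n) powr (1 / real A ^ n))) = \<infinity>"
    show "p_transcendental p (\<lambda>n. real_of_int (a n) / real_of_int (b n))"
      unfolding p_transcendental_def series
    proof (intro conjI allI impI)
      fix c :: "nat \<Rightarrow> int" assume "\<forall>n\<ge>1. \<not> int p dvd c n"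
      hence c: "\<not> int p dvd c (Suc n)" for n by simp
      show "summable (\<lambda>n. real_of_int (\<beta> n) / real_of_int (\<alpha> n * c (Suc n)))"
        by (rule summable[of c, OF c])
      show "\<not> algebraic (\<Sum>n. real_of_int (\<beta> n) / real_of_int (\<alpha> n * c (Suc n)))"
      proof
        assume "algebraic (\<Sum>n. real_of_int (\<beta> n) / real_of_int (\<alpha> n * c (Suc n)))"
        then obtain f where f: "\<And>i. coeff f i \<in> \<int>" "f \<noteq> 0"
            "poly f (\<Sum>n. real_of_int (\<beta> n) / real_of_int (\<alpha> n * c (Suc n))) = 0"
          by (rule algebraicE) blast
        have deg: "degree f > 0"
        proof (rule ccontr)
          assume "\<not> degree f > 0"
          then obtain y where "f = [:y:]" by (auto elim: degree_eq_zeroE)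
          thus False using f(2,3) by simp
        qed
        \<comment> \<open>The hypothesis is used for \<open>A = degree f + 1\<close>.\<close>
        have "frequently (\<lambda>n. log 2 (real_of_int (\<alpha> n)) \<ge> K * real (degree f + 1) ^ n) sequentially" for K
          unfolding \<alpha>_def
          by (rule limsup_powr_imp_frequently_log_ge[OF lim[rule_format] _ pos]) auto
        from not_root[of c, OF c f(1) deg this] f(3) show False by blast
      qed
    qed (use ratio_nz in auto)
  qed
qed

end
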